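(* Let $V$ be a finite-dimensional vector space over a field $F$. Then generic Coxeter pairs $[\mathcal P]\otimes[\mathcal Q]$ generate $\mathrm{St}(V)\otimes_{\mathbb Q}\mathrm{St}(V)$ as a $\mathbb Q$-vector space.
   Context: **Steinberg module.** For a $d$-dimensional vector space $V$ over $F$, $\mathrm{St}(V)=\widetilde H_{d-2}(\mathcal T_V,\mathbb Q)$ ($\mathcal T_V$ the Tits building), with $\mathrm{St}(V)=\mathbb Q$ if $d\le 1$. Equivalently it is the $\mathbb Q$-vector space generated by apartments $[v_1,\dots,v_d]$, $v_i\in V\setminus\{0\}$, which vanish for linearly dependent $v_i$, are skew-symmetric, are unchanged when a $v_i$ is multiplied by an element of $F^\times$, and satisfy $\sum_{i=0}^d(-1)^i[v_0,\dots,\widehat{v_i},\dots,v_d]=0$ for nonzero $v_0,\dots,v_d\in V$. For lines $P_i=\langle v_i\rangle$ in $V$ write $[P_1,\dots,P_d]=[v_1,\dots,v_d]$. **Coxeter pairs.** A projective simplex is an ordered $d$-tuple $\mathcal P=(P_1,\dots,P_d)$ of lines in $V$; it is non-degenerate if $P_1,\dots,P_d$ span $V$; put $[\mathcal P]=[P_1,\dots,P_d]\in\mathrm{St}(V)$. A pair $(\mathcal P,\mathcal Q)$ is a Coxeter pair if both simplexes are non-degenerate, $P_1=Q_1$, and $Q_i\subseteq\langle P_{i-1},P_i\rangle$ for $i=2,\dots,d$. It is generic if moreover $P_i\ne Q_i$ for $2\le i\le d$. The element $[\mathcal P]\otimes[\mathcal Q]$ is also called a (generic) Coxeter pair. *)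

theory Defs
  imports
    "HOL-Algebra.Algebra"
    "HOL-Library.Poly_Mapping"
    "HOL-Combinatorics.Permutations"
begin

section \<open>Vector spaces over the rationals by generators and relations\<close>

definition rat_field :: "rat ring" where
  "rat_field = \<lparr>carrier = UNIV, monoid.mult = (*), one = 1, ring.zero = 0, add = (+)\<rparr>"

text \<open>Vector spaces are modules in the sense of the library. The type of modules extends the type
  of rings, so the irrelevant fields for multiplication and unit are left unspecified.\<close>

definition free_rat_module :: "'a set \<Rightarrow> (rat, 'a \<Rightarrow>\<^sub>0 rat) module" where
  "free_rat_module S =
    \<lparr>carrier = {f. Poly_Mapping.keys f \<subseteq> S}, monoid.mult = undefined, one = undefined,
     ring.zero = 0, add = (+), smult = (\<lambda>c. Poly_Mapping.map ((*) c))\<rparr>"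

abbreviation free_gen :: "'a \<Rightarrow> ('a \<Rightarrow>\<^sub>0 rat)" where
  "free_gen x \<equiv> Poly_Mapping.single x 1"

definition submodule_generated ::
  "('r, 'k) ring_scheme \<Rightarrow> ('r, 'm, 'l) module_scheme \<Rightarrow> 'm set \<Rightarrow> 'm set" where
  "submodule_generated R M A = \<Inter>{N. submodule N R M \<and> A \<subseteq> N}"

definition quotient_module ::
  "('r, 'm, 'l) module_scheme \<Rightarrow> 'm set \<Rightarrow> ('r, 'm set) module" where
  "quotient_module M N =
    \<lparr>carrier = a_rcosets\<^bsub>M\<^esub> N, monoid.mult = undefined, one = undefined,
     ring.zero = N, add = set_add M, smult = (\<lambda>c C. \<Union>x\<in>C. N +>\<^bsub>M\<^esub> (c \<odot>\<^bsub>M\<^esub> x))\<rparr>"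

definition rat_presented :: "'a set \<Rightarrow> ('a \<Rightarrow>\<^sub>0 rat) set \<Rightarrow> (rat, ('a \<Rightarrow>\<^sub>0 rat) set) module" where
  "rat_presented S Rel =
    quotient_module (free_rat_module S)
      (submodule_generated rat_field (free_rat_module S) Rel)"

definition presented_gen :: "'a set \<Rightarrow> ('a \<Rightarrow>\<^sub>0 rat) set \<Rightarrow> 'a \<Rightarrow> ('a \<Rightarrow>\<^sub>0 rat) set" where
  "presented_gen S Rel x =
    submodule_generated rat_field (free_rat_module S) Rel +>\<^bsub>free_rat_module S\<^esub> free_gen x"


section \<open>Tensor products over the rationals\<close>

definition tensor_relations ::
  "(rat, 'm, 'k) module_scheme \<Rightarrow> (rat, 'n, 'l) module_scheme \<Rightarrow> (('m \<times> 'n) \<Rightarrow>\<^sub>0 rat) set" where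
  "tensor_relations M N =
     {free_gen (x \<oplus>\<^bsub>M\<^esub> x', y) - free_gen (x, y) - free_gen (x', y) | x x' y.
        x \<in> carrier M \<and> x' \<in> carrier M \<and> y \<in> carrier N} \<union>
     {free_gen (x, y \<oplus>\<^bsub>N\<^esub> y') - free_gen (x, y) - free_gen (x, y') | x y y'.
        x \<in> carrier M \<and> y \<in> carrier N \<and> y' \<in> carrier N} \<union>
     {free_gen (c \<odot>\<^bsub>M\<^esub> x, y) - Poly_Mapping.single (x, y) c | c x y.
        x \<in> carrier M \<and> y \<in> carrier N} \<union>
     {free_gen (x, c \<odot>\<^bsub>N\<^esub> y) - Poly_Mapping.single (x, y) c | c x y.
        x \<in> carrier M \<and> y \<in> carrier N}"

definition tensor_product ::
  "(rat, 'm, 'k) module_scheme \<Rightarrow> (rat, 'n, 'l) module_scheme \<Rightarrow>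
    (rat, (('m \<times> 'n) \<Rightarrow>\<^sub>0 rat) set) module" where
  "tensor_product M N = rat_presented (carrier M \<times> carrier N) (tensor_relations M N)"

definition pure_tensor ::
  "(rat, 'm, 'k) module_scheme \<Rightarrow> (rat, 'n, 'l) module_scheme \<Rightarrow> 'm \<Rightarrow> 'n \<Rightarrow>
    (('m \<times> 'n) \<Rightarrow>\<^sub>0 rat) set" where
  "pure_tensor M N x y =
    presented_gen (carrier M \<times> carrier N) (tensor_relations M N) (x, y)"


section \<open>The Steinberg module\<close>

text \<open>Throughout, \<open>s\<close> is the scalar multiplication of a vector space whose set of vectors is the
  whole type \<open>'v\<close>, and \<open>d\<close> is its dimension. Tuples are lists indexed from \<open>0\<close>.\<close>

definition nonzero_tuples :: "nat \<Rightarrow> 'v::zero list set" where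
  "nonzero_tuples n = {vs. length vs = n \<and> 0 \<notin> set vs}"

definition independent_tuple ::
  "('f::field \<Rightarrow> 'v::ab_group_add \<Rightarrow> 'v) \<Rightarrow> 'v list \<Rightarrow> bool" where
  "independent_tuple s vs \<longleftrightarrow> distinct vs \<and> \<not> module.dependent s (set vs)"

definition steinberg_relations ::
  "('f::field \<Rightarrow> 'v::ab_group_add \<Rightarrow> 'v) \<Rightarrow> ('v list \<Rightarrow>\<^sub>0 rat) set" where
  "steinberg_relations s = (let d = vector_space.dim s UNIV in
     {free_gen vs | vs. vs \<in> nonzero_tuples d \<and> \<not> independent_tuple s vs} \<union>
     {free_gen (permute_list \<sigma> vs) - Poly_Mapping.single vs (of_int (sign \<sigma>)) | \<sigma> vs.
        vs \<in> nonzero_tuples d \<and> \<sigma> permutes {..<d}} \<union>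
     {free_gen (vs[i := s a (vs ! i)]) - free_gen vs | vs i a.
        vs \<in> nonzero_tuples d \<and> i < d \<and> a \<noteq> 0} \<union>
     {\<Sum>i\<le>d. Poly_Mapping.single (take i vs @ drop (Suc i) vs) ((-1) ^ i) | vs.
        vs \<in> nonzero_tuples (Suc d)})"

text \<open>For \<open>d = 0\<close> there are no relations and one generator, the empty tuple; for \<open>d = 1\<close> all
  generators are identified. In both cases the result is one-dimensional.\<close>

definition steinberg ::
  "('f::field \<Rightarrow> 'v::ab_group_add \<Rightarrow> 'v) \<Rightarrow> (rat, ('v list \<Rightarrow>\<^sub>0 rat) set) module" where
  "steinberg s = rat_presented (nonzero_tuples (vector_space.dim s UNIV)) (steinberg_relations s)"

definition apartment ::
  "('f::field \<Rightarrow> 'v::ab_group_add \<Rightarrow> 'v) \<Rightarrow> 'v list \<Rightarrow> ('v list \<Rightarrow>\<^sub>0 rat) set" where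
  "apartment s vs =
    presented_gen (nonzero_tuples (vector_space.dim s UNIV)) (steinberg_relations s) vs"


section \<open>Coxeter pairs\<close>

definition is_line :: "('f::field \<Rightarrow> 'v::ab_group_add \<Rightarrow> 'v) \<Rightarrow> 'v set \<Rightarrow> bool" where
  "is_line s L \<longleftrightarrow> (\<exists>v. v \<noteq> 0 \<and> L = module.span s {v})"

definition projective_simplex ::
  "('f::field \<Rightarrow> 'v::ab_group_add \<Rightarrow> 'v) \<Rightarrow> 'v set list \<Rightarrow> bool" where
  "projective_simplex s P \<longleftrightarrow> length P = vector_space.dim s UNIV \<and> (\<forall>L\<in>set P. is_line s L)"

definition nondegenerate ::
  "('f::field \<Rightarrow> 'v::ab_group_add \<Rightarrow> 'v) \<Rightarrow> 'v set list \<Rightarrow> bool" where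
  "nondegenerate s P \<longleftrightarrow> module.span s (\<Union>(set P)) = UNIV"

definition line_generator ::
  "('f::field \<Rightarrow> 'v::ab_group_add \<Rightarrow> 'v) \<Rightarrow> 'v set \<Rightarrow> 'v" where
  "line_generator s L = (SOME v. v \<noteq> 0 \<and> L = module.span s {v})"

text \<open>By the scaling relation, the class of a projective simplex does not depend on the choice of
  the generators of its lines.\<close>

definition simplex_class ::
  "('f::field \<Rightarrow> 'v::ab_group_add \<Rightarrow> 'v) \<Rightarrow> 'v set list \<Rightarrow> ('v list \<Rightarrow>\<^sub>0 rat) set" where
  "simplex_class s P = apartment s (map (line_generator s) P)"

definition coxeter_pair ::
  "('f::field \<Rightarrow> 'v::ab_group_add \<Rightarrow> 'v) \<Rightarrow> 'v set list \<Rightarrow> 'v set list \<Rightarrow> bool" where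
  "coxeter_pair s P Q \<longleftrightarrow>
     projective_simplex s P \<and> nondegenerate s P \<and>
     projective_simplex s Q \<and> nondegenerate s Q \<and>
     (0 < vector_space.dim s UNIV \<longrightarrow> P ! 0 = Q ! 0) \<and>
     (\<forall>i. 0 < i \<and> i < vector_space.dim s UNIV \<longrightarrow>
        Q ! i \<subseteq> module.span s (P ! (i - 1) \<union> P ! i))"

definition generic_coxeter_pair ::
  "('f::field \<Rightarrow> 'v::ab_group_add \<Rightarrow> 'v) \<Rightarrow> 'v set list \<Rightarrow> 'v set list \<Rightarrow> bool" where
  "generic_coxeter_pair s P Q \<longleftrightarrow>
     coxeter_pair s P Q \<and> (\<forall>i. 0 < i \<and> i < vector_space.dim s UNIV \<longrightarrow> P ! i \<noteq> Q ! i)"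

definition generic_coxeter_elements ::
  "('f::field \<Rightarrow> 'v::ab_group_add \<Rightarrow> 'v) \<Rightarrow>
    ((('v list \<Rightarrow>\<^sub>0 rat) set \<times> ('v list \<Rightarrow>\<^sub>0 rat) set) \<Rightarrow>\<^sub>0 rat) set set" where
  "generic_coxeter_elements s =
    {pure_tensor (steinberg s) (steinberg s) (simplex_class s P) (simplex_class s Q) | P Q.
       generic_coxeter_pair s P Q}"

end

theory Submission
  imports Defs
begin

text \<open>
  Fix a submodule \<open>P\<close> of \<open>St(V) \<otimes> St(V)\<close> containing the generic Coxeter pairs, and let \<open>M p q\<close> say that
  \<open>[p] \<otimes> [q]\<close> lies in \<open>P\<close>. In each argument, \<open>M\<close> is invariant under permutations, holds on dependent
  tuples, and satisfies an exchange rule: if it holds whenever one entry of \<open>xs\<close> is replaced by a fixed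
  \<open>w \<noteq> 0\<close>, it holds for \<open>xs\<close>.

  First, Coxeter pairs generate, even those with a prescribed last line \<open>\<langle>l\<rangle>\<close> of \<open>p\<close>. The exchange rule
  with \<open>w = l\<close> reduces to \<open>p = (x, l)\<close>; with \<open>F = \<langle>x\<rangle>\<close>, exchanging two entries of \<open>q\<close> outside \<open>F\<close>
  against a combination of them inside \<open>F\<close> reduces to \<open>q = (y, r)\<close> with \<open>y\<close> in \<open>F\<close>; after rescaling,
  \<open>r = l - w\<close> with \<open>w \<in> F\<close>, and the claim follows by induction for \<open>F\<close> with prescribed last line \<open>\<langle>w\<rangle>\<close>.

  Second, up to scaling a Coxeter pair cuts \<open>p\<close> into consecutive blocks \<open>(a, b, c, \<dots>)\<close>, with corresponding
  blocks \<open>(a, b - a, c - b, \<dots>)\<close> of \<open>q\<close>; it is generic if there is one block. Reading \<open>v - u\<close> as an edge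
  from \<open>u\<close> to \<open>v\<close>, the blocks of \<open>q\<close> are paths from \<open>0\<close>. The three-term relation for
  \<open>x - v\<close>, \<open>y - v\<close> and \<open>y - x\<close> expresses two paths from a common vertex as a signed sum of paths through
  all shuffles of their vertices, so blocks can be merged until one is left.
\<close>

section \<open>Presented modules and tensor products\<close>

lemma (in Module.module) quotient_module_facts:
  assumes N: "submodule N R M"
  shows carrier_quotient_module: "carrier (quotient_module M N) = (\<lambda>x. N +>\<^bsub>M\<^esub> x) ` carrier M"
    and quotient_module_add: "\<lbrakk>x \<in> carrier M; y \<in> carrier M\<rbrakk> \<Longrightarrow>
      (N +>\<^bsub>M\<^esub> x) \<oplus>\<^bsub>quotient_module M N\<^esub> (N +>\<^bsub>M\<^esub> y) = N +>\<^bsub>M\<^esub> (x \<oplus>\<^bsub>M\<^esub> y)"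
    and quotient_module_smult: "\<lbrakk>c \<in> carrier R; x \<in> carrier M\<rbrakk> \<Longrightarrow>
      c \<odot>\<^bsub>quotient_module M N\<^esub> (N +>\<^bsub>M\<^esub> x) = N +>\<^bsub>M\<^esub> (c \<odot>\<^bsub>M\<^esub> x)"
    and quotient_module_zero: "x \<in> N \<Longrightarrow> N +>\<^bsub>M\<^esub> x = \<zero>\<^bsub>quotient_module M N\<^esub>"
    and module_quotient_module: "Module.module R (quotient_module M N)"
proof -
  have sub: "subgroup N (add_monoid M)" using N by (rule submodule.axioms)
  interpret Q: abelian_subgroup N M
    by (intro abelian_subgroupI3 additive_subgroupI sub M.abelian_group_axioms)
  have NM: "N \<subseteq> carrier M" using Q.a_subset .
  show carr: "carrier (quotient_module M N) = (\<lambda>x. N +>\<^bsub>M\<^esub> x) ` carrier M"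
    by (auto simp: quotient_module_def A_RCOSETS_def')
  show add: "(N +>\<^bsub>M\<^esub> x) \<oplus>\<^bsub>quotient_module M N\<^esub> (N +>\<^bsub>M\<^esub> y) = N +>\<^bsub>M\<^esub> (x \<oplus>\<^bsub>M\<^esub> y)"
    if "x \<in> carrier M" "y \<in> carrier M" for x y
    using that by (simp add: quotient_module_def Q.a_rcos_sum)
  show smult: "c \<odot>\<^bsub>quotient_module M N\<^esub> (N +>\<^bsub>M\<^esub> x) = N +>\<^bsub>M\<^esub> (c \<odot>\<^bsub>M\<^esub> x)"
    if c: "c \<in> carrier R" and x: "x \<in> carrier M" for c x
  proof -
    \<comment> \<open>The scalar action is a union over representatives. All its terms coincide: two
      representatives differ by an element of \<open>N\<close>, and \<open>N\<close> is closed under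
      scalars.\<close>
    have "N +>\<^bsub>M\<^esub> (c \<odot>\<^bsub>M\<^esub> y) = N +>\<^bsub>M\<^esub> (c \<odot>\<^bsub>M\<^esub> x)" if y: "y \<in> N +>\<^bsub>M\<^esub> x" for y
    proof -
      obtain n where n: "n \<in> N" "y = n \<oplus>\<^bsub>M\<^esub> x" using y by (auto simp: a_r_coset_def')
      then have "c \<odot>\<^bsub>M\<^esub> y = (c \<odot>\<^bsub>M\<^esub> n) \<oplus>\<^bsub>M\<^esub> (c \<odot>\<^bsub>M\<^esub> x)"
        using c x NM by (auto simp: smult_r_distr)
      moreover have "c \<odot>\<^bsub>M\<^esub> n \<in> N" using N c n by (simp add: submodule.smult_closed)
      ultimately have "c \<odot>\<^bsub>M\<^esub> y \<in> N +>\<^bsub>M\<^esub> (c \<odot>\<^bsub>M\<^esub> x)" by (auto simp: a_r_coset_def')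
      then show ?thesis using M.a_repr_independence[OF _ _ sub] c x by (metis smult_closed)
    qed
    then have "(\<Union>y\<in>N +>\<^bsub>M\<^esub> x. N +>\<^bsub>M\<^esub> (c \<odot>\<^bsub>M\<^esub> y)) = (\<Union>y\<in>N +>\<^bsub>M\<^esub> x. N +>\<^bsub>M\<^esub> (c \<odot>\<^bsub>M\<^esub> x))"
      by (rule SUP_cong[OF refl])
    moreover have "N +>\<^bsub>M\<^esub> x \<noteq> {}" using Q.a_rcos_self[OF x] by blast
    ultimately show ?thesis by (simp add: quotient_module_def)
  qed
  show "N +>\<^bsub>M\<^esub> x = \<zero>\<^bsub>quotient_module M N\<^esub>" if "x \<in> N"
    using that NM sub by (auto simp: quotient_module_def M.a_coset_join2)
  show "Module.module R (quotient_module M N)"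
  proof (rule moduleI[OF R.cring_axioms])
    interpret C: comm_group "M A_Mod N" by (rule Q.a_factorgroup_is_comm_group)
    \<comment> \<open>The ring multiplication of \<open>quotient_module\<close> is unspecified, so
      only carrier, addition and zero are compared with the factor group \<open>M A_Mod N\<close>;
      these data determine the abelian group axioms.\<close>
    have eq: "carrier (quotient_module M N) = carrier (M A_Mod N)"
      "ring.add (quotient_module M N) = monoid.mult (M A_Mod N)" "ring.zero (quotient_module M N) = one (M A_Mod N)"
      by (simp_all add: quotient_module_def A_FactGroup_def')
    show "abelian_group (quotient_module M N)"
      by (rule abelian_groupI, unfold eq)
        (simp_all add: C.m_ac C.l_inv_ex del: add_A_FactGroup)
  qed (auto simp: carr add smult smult_l_distr smult_r_distr smult_assoc1)
qed

text \<open>The hypothesis puts \<open>carrier M\<close> itself into the intersected family, which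
  bounds the intersection; closure is inherited from the members.\<close>

lemma (in Module.module) submodule_generated_submodule:
  assumes "A \<subseteq> carrier M"
  shows "submodule (submodule_generated R M A) R M"
proof (rule submoduleI)
  show "submodule_generated R M A \<subseteq> carrier M"
    using assms carrier_is_submodule unfolding submodule_generated_def by blast
  have "\<zero>\<^bsub>M\<^esub> \<in> N" if "submodule N R M" for N
    using subgroup.one_closed[OF submodule.axioms(1)[OF that]] by simp
  then show "\<zero>\<^bsub>M\<^esub> \<in> submodule_generated R M A" by (simp add: submodule_generated_def)
qed (auto simp: submodule_generated_def intro: submoduleE)

text \<open>Serves to pull a submodule back along the quotient map of a presentation and along the
  tensor product with one factor fixed.\<close>

lemma submodule_preimage:
  assumes M: "Module.module R M" and T: "Module.module R T" and P: "submodule P R T"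
    and closed: "\<And>x. x \<in> carrier M \<Longrightarrow> h x \<in> carrier T"
    and add: "\<And>x y. \<lbrakk>x \<in> carrier M; y \<in> carrier M\<rbrakk> \<Longrightarrow> h (x \<oplus>\<^bsub>M\<^esub> y) = h x \<oplus>\<^bsub>T\<^esub> h y"
    and smult: "\<And>c x. \<lbrakk>c \<in> carrier R; x \<in> carrier M\<rbrakk> \<Longrightarrow> h (c \<odot>\<^bsub>M\<^esub> x) = c \<odot>\<^bsub>T\<^esub> h x"
  shows "submodule {x \<in> carrier M. h x \<in> P} R M"
proof -
  interpret M: Module.module R M by fact
  interpret T: Module.module R T by fact
  let ?U = "{x \<in> carrier M. h x \<in> P}"
  have scale: "c \<odot>\<^bsub>M\<^esub> x \<in> ?U" if "c \<in> carrier R" "x \<in> ?U" for c x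
  proof -
    have "c \<odot>\<^bsub>T\<^esub> h x \<in> P" using that by (intro T.submoduleE(4)[OF P]) simp_all
    then show ?thesis using that smult by simp
  qed
  show ?thesis
  proof (rule M.submoduleI)
    \<comment> \<open>Preservation of zero comes from scaling by zero, and closure under negatives
      below from scaling by minus one.\<close>
    have "h \<zero>\<^bsub>M\<^esub> = h (\<zero>\<^bsub>R\<^esub> \<odot>\<^bsub>M\<^esub> \<zero>\<^bsub>M\<^esub>)" by simp
    also have "\<dots> = \<zero>\<^bsub>T\<^esub>" using closed by (subst smult) simp_all
    finally show "\<zero>\<^bsub>M\<^esub> \<in> ?U"
      using subgroup.one_closed[OF submodule.axioms(1)[OF P]] by simp
    show "\<ominus>\<^bsub>M\<^esub> x \<in> ?U" if x: "x \<in> ?U" for x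
    proof -
      have "\<ominus>\<^bsub>M\<^esub> x = (\<ominus>\<^bsub>R\<^esub> \<one>\<^bsub>R\<^esub>) \<odot>\<^bsub>M\<^esub> x" using x by (simp add: M.smult_l_minus)
      then show ?thesis using scale[OF _ x, of "\<ominus>\<^bsub>R\<^esub> \<one>\<^bsub>R\<^esub>"] by simp
    qed
    show "x \<oplus>\<^bsub>M\<^esub> y \<in> ?U" if "x \<in> ?U" "y \<in> ?U" for x y
    proof -
      have "h x \<oplus>\<^bsub>T\<^esub> h y \<in> P" using that by (intro T.submoduleE(5)[OF P]) simp_all
      then show ?thesis using that add by simp
    qed
  qed (use scale in auto)
qed

lemma submodule_generated_superset: "A \<subseteq> submodule_generated R M A"
  unfolding submodule_generated_def by blast

lemma submodule_generated_least: "submodule N R M \<Longrightarrow> A \<subseteq> N \<Longrightarrow> submodule_generated R M A \<subseteq> N"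
  unfolding submodule_generated_def by blast

section \<open>Free rational vector spaces and presentations\<close>

lemma rat_field_simps [simp]:
  "carrier rat_field = UNIV" "x \<otimes>\<^bsub>rat_field\<^esub> y = x * y" "\<one>\<^bsub>rat_field\<^esub> = 1"
  "\<zero>\<^bsub>rat_field\<^esub> = 0" "x \<oplus>\<^bsub>rat_field\<^esub> y = x + y"
  by (simp_all add: rat_field_def)

lemma cring_rat_field: "cring rat_field"
proof (intro cringI abelian_groupI comm_monoidI)
  show "\<exists>y\<in>carrier rat_field. y \<oplus>\<^bsub>rat_field\<^esub> x = \<zero>\<^bsub>rat_field\<^esub>" for x
    by (simp add: exI[of _ "- x"])
qed (auto simp: algebra_simps)

abbreviation rat_scale :: "rat \<Rightarrow> ('a \<Rightarrow>\<^sub>0 rat) \<Rightarrow> 'a \<Rightarrow>\<^sub>0 rat" where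
  "rat_scale c \<equiv> Poly_Mapping.map ((*) c)"

lemma lookup_rat_scale [simp]: "Poly_Mapping.lookup (rat_scale c f) k = c * Poly_Mapping.lookup f k"
  by (simp add: Poly_Mapping.map.rep_eq when_def)

lemma rat_scale_single [simp]: "rat_scale c (Poly_Mapping.single k b) = Poly_Mapping.single k (c * b)"
  by (rule poly_mapping_eqI) (simp add: lookup_single when_def)

lemma free_rat_module_simps [simp]:
  "carrier (free_rat_module S) = {f. Poly_Mapping.keys f \<subseteq> S}"
  "\<zero>\<^bsub>free_rat_module S\<^esub> = 0" "f \<oplus>\<^bsub>free_rat_module S\<^esub> g = f + g"
  "c \<odot>\<^bsub>free_rat_module S\<^esub> f = rat_scale c f"
  by (simp_all add: free_rat_module_def)

lemma module_free_rat_module: "Module.module rat_field (free_rat_module S)"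
proof (intro moduleI cring_rat_field abelian_groupI)
  fix f assume f: "f \<in> carrier (free_rat_module S)"
  have "rat_scale (-1) f + f = 0"
    by (rule poly_mapping_eqI) (simp add: lookup_add)
  moreover have "Poly_Mapping.keys (rat_scale (-1) f) = Poly_Mapping.keys f"
    by (auto simp: in_keys_iff)
  ultimately show "\<exists>g\<in>carrier (free_rat_module S). g \<oplus>\<^bsub>free_rat_module S\<^esub> f = \<zero>\<^bsub>free_rat_module S\<^esub>"
    using f by auto
next
  fix f g :: "'a \<Rightarrow>\<^sub>0 rat"
  assume "f \<in> carrier (free_rat_module S)" "g \<in> carrier (free_rat_module S)"
  then show "f \<oplus>\<^bsub>free_rat_module S\<^esub> g \<in> carrier (free_rat_module S)"
    using Poly_Mapping.keys_add[of f g] by auto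
qed (auto intro!: poly_mapping_eqI simp: lookup_add algebra_simps in_keys_iff)

text \<open>Translates the submodule axioms into \<open>Poly_Mapping\<close> arithmetic. The
  equivalence for nonzero coefficients later strips signs from relations.\<close>

lemma free_rat_submodule:
  assumes "submodule U rat_field (free_rat_module S)"
  shows free_rat_submodule_diff: "f \<in> U \<Longrightarrow> g \<in> U \<Longrightarrow> f - g \<in> U"
    and free_rat_submodule_single: "free_gen x \<in> U \<Longrightarrow> Poly_Mapping.single x c \<in> U"
    and free_rat_submodule_single_iff: "c \<noteq> 0 \<Longrightarrow> Poly_Mapping.single x c \<in> U \<longleftrightarrow> free_gen x \<in> U"
    and free_rat_submodule_sum: "(\<And>i. i \<in> I \<Longrightarrow> h i \<in> U) \<Longrightarrow> sum h I \<in> U"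
proof -
  interpret F: Module.module rat_field "free_rat_module S" by (rule module_free_rat_module)
  have add: "f + g \<in> U" if "f \<in> U" "g \<in> U" for f g
    using F.submoduleE(5)[OF assms] that by simp
  have scale: "rat_scale c f \<in> U" if "f \<in> U" for c f
    using F.submoduleE(4)[OF assms] that by simp
  show "f - g \<in> U" if "f \<in> U" "g \<in> U" for f g
  proof -
    have "f - g = f + rat_scale (-1) g"
      by (rule poly_mapping_eqI) (simp add: lookup_add lookup_minus)
    then show ?thesis by (simp only:) (intro add scale that)
  qed
  have zero: "0 \<in> U" using subgroup.one_closed[OF submodule.axioms(1)[OF assms]] by simp
  show single: "Poly_Mapping.single x c \<in> U" if "free_gen x \<in> U" for x c
    using scale[OF that, of c] by simp
  show "Poly_Mapping.single x c \<in> U \<longleftrightarrow> free_gen x \<in> U" if "c \<noteq> 0"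
  proof
    assume "Poly_Mapping.single x c \<in> U"
    then have "rat_scale (inverse c) (Poly_Mapping.single x c) \<in> U" by (rule scale)
    then show "free_gen x \<in> U" using that by simp
  qed (rule single)
  show "sum h I \<in> U" if "\<And>i. i \<in> I \<Longrightarrow> h i \<in> U"
    using that
  proof (induction I rule: infinite_finite_induct)
    case (insert i I)
    then show ?case using add[of "h i" "sum h I"] by simp
  qed (use zero in simp_all)
qed

text \<open>A finitely supported function is the finite sum of its one-point pieces, each a multiple
  of a generator.\<close>

lemma free_rat_submodule_eq_carrier:
  assumes U: "submodule U rat_field (free_rat_module S)" and gens: "\<And>x. x \<in> S \<Longrightarrow> free_gen x \<in> U"
  shows "U = carrier (free_rat_module S)"
proof
  show "U \<subseteq> carrier (free_rat_module S)"
    using Module.module.submoduleE(1)[OF module_free_rat_module U] .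
  show "carrier (free_rat_module S) \<subseteq> U"
  proof
    fix f assume f: "f \<in> carrier (free_rat_module S)"
    have "f = (\<Sum>x\<in>Poly_Mapping.keys f. Poly_Mapping.single x (Poly_Mapping.lookup f x))"
    proof (rule poly_mapping_eqI)
      fix k
      have "(\<Sum>x\<in>Poly_Mapping.keys f. Poly_Mapping.lookup f x when x = k) =
          (\<Sum>x\<in>Poly_Mapping.keys f. if x = k then Poly_Mapping.lookup f x else 0)"
        by (simp add: when_def)
      also have "\<dots> = Poly_Mapping.lookup f k" by (simp add: in_keys_iff)
      finally show "Poly_Mapping.lookup f k = Poly_Mapping.lookup (\<Sum>x\<in>Poly_Mapping.keys f.
          Poly_Mapping.single x (Poly_Mapping.lookup f x)) k"
        by (simp add: lookup_sum lookup_single)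
    qed
    also have "\<dots> \<in> U"
    proof (rule free_rat_submodule_sum[OF U])
      fix x assume "x \<in> Poly_Mapping.keys f"
      then have "free_gen x \<in> U" using f gens by auto
      then show "Poly_Mapping.single x (Poly_Mapping.lookup f x) \<in> U"
        by (rule free_rat_submodule_single[OF U])
    qed
    finally show "f \<in> U" .
  qed
qed

text \<open>The quotient map on all formal combinations, extending \<open>presented_gen\<close> so
  that its linearity can be stated.\<close>

definition presented_class :: "'a set \<Rightarrow> ('a \<Rightarrow>\<^sub>0 rat) set \<Rightarrow> ('a \<Rightarrow>\<^sub>0 rat) \<Rightarrow> ('a \<Rightarrow>\<^sub>0 rat) set" where
  "presented_class S Rel f =
     submodule_generated rat_field (free_rat_module S) Rel +>\<^bsub>free_rat_module S\<^esub> f"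

lemma presented_gen_class: "presented_gen S Rel x = presented_class S Rel (free_gen x)"
  by (simp add: presented_gen_def presented_class_def)

lemma rat_presented_facts:
  assumes Rel: "Rel \<subseteq> carrier (free_rat_module S)"
  shows module_rat_presented: "Module.module rat_field (rat_presented S Rel)"
    and carrier_rat_presented:
      "carrier (rat_presented S Rel) = presented_class S Rel ` carrier (free_rat_module S)"
    and presented_class_add: "\<lbrakk>f \<in> carrier (free_rat_module S); g \<in> carrier (free_rat_module S)\<rbrakk> \<Longrightarrow>
      presented_class S Rel (f + g) = presented_class S Rel f \<oplus>\<^bsub>rat_presented S Rel\<^esub> presented_class S Rel g"
    and presented_class_scale: "f \<in> carrier (free_rat_module S) \<Longrightarrow>
      presented_class S Rel (rat_scale c f) = c \<odot>\<^bsub>rat_presented S Rel\<^esub> presented_class S Rel f"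
    and presented_class_relation: "r \<in> Rel \<Longrightarrow> presented_class S Rel r = \<zero>\<^bsub>rat_presented S Rel\<^esub>"
proof -
  interpret F: Module.module rat_field "free_rat_module S" by (rule module_free_rat_module)
  note K = F.submodule_generated_submodule[OF Rel]
  note facts = F.quotient_module_facts[OF K]
  show "Module.module rat_field (rat_presented S Rel)"
    unfolding rat_presented_def by (rule facts)
  show "carrier (rat_presented S Rel) = presented_class S Rel ` carrier (free_rat_module S)"
    unfolding rat_presented_def presented_class_def by (rule facts)
  show "presented_class S Rel (f + g) = presented_class S Rel f \<oplus>\<^bsub>rat_presented S Rel\<^esub> presented_class S Rel g"
    if "f \<in> carrier (free_rat_module S)" "g \<in> carrier (free_rat_module S)" for f g
    using facts(2)[OF that] unfolding rat_presented_def presented_class_def by simp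
  show "presented_class S Rel (rat_scale c f) = c \<odot>\<^bsub>rat_presented S Rel\<^esub> presented_class S Rel f"
    if "f \<in> carrier (free_rat_module S)"
    using facts(3)[of c, OF _ that] unfolding rat_presented_def presented_class_def by simp
  show "presented_class S Rel r = \<zero>\<^bsub>rat_presented S Rel\<^esub>" if "r \<in> Rel"
    unfolding rat_presented_def presented_class_def
    by (rule facts(4)[OF subsetD[OF submodule_generated_superset that]])
qed

lemma presented_gen_carrier:
  assumes "Rel \<subseteq> carrier (free_rat_module S)" "x \<in> S"
  shows "presented_gen S Rel x \<in> carrier (rat_presented S Rel)"
  unfolding carrier_rat_presented[OF assms(1)] presented_gen_class
  using assms(2) by (intro imageI) simp

text \<open>Replaces a submodule of the quotient by its preimage, where relations are actual members
  that can be added and subtracted.\<close>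

lemma presented_class_preimage:
  assumes Rel: "Rel \<subseteq> carrier (free_rat_module S)" and P: "submodule P rat_field (rat_presented S Rel)"
  shows "submodule {f \<in> carrier (free_rat_module S). presented_class S Rel f \<in> P} rat_field (free_rat_module S)"
    and "Rel \<subseteq> {f \<in> carrier (free_rat_module S). presented_class S Rel f \<in> P}"
proof -
  interpret F: Module.module rat_field "free_rat_module S" by (rule module_free_rat_module)
  interpret M: Module.module rat_field "rat_presented S Rel" by (rule module_rat_presented[OF Rel])
  have "\<zero>\<^bsub>rat_presented S Rel\<^esub> \<in> P"
    using subgroup.one_closed[OF submodule.axioms(1)[OF P]] by simp
  then show "Rel \<subseteq> {f \<in> carrier (free_rat_module S). presented_class S Rel f \<in> P}"
    using Rel presented_class_relation[OF Rel] by auto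
  show "submodule {f \<in> carrier (free_rat_module S). presented_class S Rel f \<in> P} rat_field (free_rat_module S)"
    using presented_class_add[OF Rel] presented_class_scale[OF Rel] carrier_rat_presented[OF Rel]
    by (intro submodule_preimage[OF F.module_axioms M.module_axioms P]) simp_all
qed

lemma rat_presented_submodule_eq_carrier:
  assumes Rel: "Rel \<subseteq> carrier (free_rat_module S)" and P: "submodule P rat_field (rat_presented S Rel)"
    and gens: "\<And>x. x \<in> S \<Longrightarrow> presented_gen S Rel x \<in> P"
  shows "P = carrier (rat_presented S Rel)"
proof
  interpret M: Module.module rat_field "rat_presented S Rel" by (rule module_rat_presented[OF Rel])
  show "P \<subseteq> carrier (rat_presented S Rel)" using M.submoduleE(1)[OF P] .
  have "{f \<in> carrier (free_rat_module S). presented_class S Rel f \<in> P} = carrier (free_rat_module S)"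
    by (rule free_rat_submodule_eq_carrier[OF presented_class_preimage(1)[OF Rel P]])
      (use gens in \<open>auto simp: presented_gen_class\<close>)
  then show "carrier (rat_presented S Rel) \<subseteq> P"
    unfolding carrier_rat_presented[OF Rel] by blast
qed

lemma presented_gen_eqI:
  assumes Rel: "Rel \<subseteq> carrier (free_rat_module S)" and "free_gen x - free_gen y \<in> Rel"
    and xy: "x \<in> S" "y \<in> S"
  shows "presented_gen S Rel x = presented_gen S Rel y"
proof -
  interpret M: Module.module rat_field "rat_presented S Rel" by (rule module_rat_presented[OF Rel])
  let ?r = "free_gen x - free_gen y"
  have "presented_class S Rel (?r + free_gen y) =
      presented_class S Rel ?r \<oplus>\<^bsub>rat_presented S Rel\<^esub> presented_class S Rel (free_gen y)"
    using assms by (intro presented_class_add[OF Rel]) auto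
  moreover have "presented_class S Rel (free_gen y) \<in> carrier (rat_presented S Rel)"
    using presented_gen_carrier[OF Rel xy(2)] by (simp add: presented_gen_class)
  ultimately show ?thesis using presented_class_relation[OF Rel assms(2)] by (simp add: presented_gen_class)
qed

section \<open>Tensor products and fixing one factor\<close>

lemma tensor_relations_carrier:
  assumes "Module.module rat_field M" "Module.module rat_field N"
  shows "tensor_relations M N \<subseteq> carrier (free_rat_module (carrier M \<times> carrier N))"
proof -
  interpret M: Module.module rat_field M by fact
  interpret N: Module.module rat_field N by fact
  let ?C = "carrier (free_rat_module (carrier M \<times> carrier N))"
  have diff: "f - g \<in> ?C" if "f \<in> ?C" "g \<in> ?C" for f g
    using free_rat_submodule_diff[OF Module.module.carrier_is_submodule[OF module_free_rat_module]] that
    by blast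
  have single: "Poly_Mapping.single (x, y) c \<in> ?C" if "x \<in> carrier M" "y \<in> carrier N" for x y c
    using that by simp
  show ?thesis
    unfolding tensor_relations_def
    by (auto simp del: free_rat_module_simps intro!: diff single)
qed

text \<open>Each identity is one family of \<open>tensor_relations\<close>: a relation has class
  zero, so the two sides of the difference have the same class.\<close>

lemma pure_tensor_facts:
  assumes M: "Module.module rat_field M" and N: "Module.module rat_field N"
  shows pure_tensor_add_left: "\<lbrakk>x \<in> carrier M; x' \<in> carrier M; y \<in> carrier N\<rbrakk> \<Longrightarrow>
      pure_tensor M N (x \<oplus>\<^bsub>M\<^esub> x') y = pure_tensor M N x y \<oplus>\<^bsub>tensor_product M N\<^esub> pure_tensor M N x' y"
    and pure_tensor_add_right: "\<lbrakk>x \<in> carrier M; y \<in> carrier N; y' \<in> carrier N\<rbrakk> \<Longrightarrow>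
      pure_tensor M N x (y \<oplus>\<^bsub>N\<^esub> y') = pure_tensor M N x y \<oplus>\<^bsub>tensor_product M N\<^esub> pure_tensor M N x y'"
    and pure_tensor_smult_left: "\<lbrakk>x \<in> carrier M; y \<in> carrier N\<rbrakk> \<Longrightarrow>
      pure_tensor M N (c \<odot>\<^bsub>M\<^esub> x) y = c \<odot>\<^bsub>tensor_product M N\<^esub> pure_tensor M N x y"
    and pure_tensor_smult_right: "\<lbrakk>x \<in> carrier M; y \<in> carrier N\<rbrakk> \<Longrightarrow>
      pure_tensor M N x (c \<odot>\<^bsub>N\<^esub> y) = c \<odot>\<^bsub>tensor_product M N\<^esub> pure_tensor M N x y"
proof -
  interpret M: Module.module rat_field M by fact
  interpret N: Module.module rat_field N by fact
  let ?S = "carrier M \<times> carrier N" and ?Rel = "tensor_relations M N"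
  note Rel = tensor_relations_carrier[OF M N]
  interpret T: Module.module rat_field "rat_presented ?S ?Rel" by (rule module_rat_presented[OF Rel])
  let ?cl = "presented_class ?S ?Rel"
  have cl: "?cl f \<in> carrier (rat_presented ?S ?Rel)" if "f \<in> carrier (free_rat_module ?S)" for f
    using that carrier_rat_presented[OF Rel] by auto
  have diff: "?cl f = ?cl g"
    if "f - g \<in> ?Rel" "f \<in> carrier (free_rat_module ?S)" "g \<in> carrier (free_rat_module ?S)" for f g
  proof -
    have "?cl ((f - g) + g) = ?cl (f - g) \<oplus>\<^bsub>rat_presented ?S ?Rel\<^esub> ?cl g"
      using that Rel by (intro presented_class_add[OF Rel]) auto
    then show ?thesis using presented_class_relation[OF Rel that(1)] cl[OF that(3)] by simp
  qed
  have add: "?cl (free_gen a) = ?cl (free_gen b) \<oplus>\<^bsub>rat_presented ?S ?Rel\<^esub> ?cl (free_gen c)"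
    if "free_gen a - free_gen b - free_gen c \<in> ?Rel" "a \<in> ?S" "b \<in> ?S" "c \<in> ?S" for a b c
  proof -
    have bc: "free_gen b + free_gen c \<in> carrier (free_rat_module ?S)"
      using that Poly_Mapping.keys_add[of "free_gen b" "free_gen c"] by auto
    have "?cl (free_gen a) = ?cl (free_gen b + free_gen c)"
      using that bc by (intro diff) (simp_all add: diff_diff_eq)
    also have "\<dots> = ?cl (free_gen b) \<oplus>\<^bsub>rat_presented ?S ?Rel\<^esub> ?cl (free_gen c)"
      using that by (intro presented_class_add[OF Rel]) simp_all
    finally show ?thesis .
  qed
  have scale: "?cl (free_gen a) = c \<odot>\<^bsub>rat_presented ?S ?Rel\<^esub> ?cl (free_gen b)"
    if "free_gen a - Poly_Mapping.single b c \<in> ?Rel" "a \<in> ?S" "b \<in> ?S" for a b c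
  proof -
    have "?cl (free_gen a) = ?cl (rat_scale c (free_gen b))"
      using that by (intro diff) simp_all
    also have "\<dots> = c \<odot>\<^bsub>rat_presented ?S ?Rel\<^esub> ?cl (free_gen b)"
      using that by (intro presented_class_scale[OF Rel]) simp_all
    finally show ?thesis .
  qed
  note defs = pure_tensor_def tensor_product_def presented_gen_class
  show "pure_tensor M N (x \<oplus>\<^bsub>M\<^esub> x') y = pure_tensor M N x y \<oplus>\<^bsub>tensor_product M N\<^esub> pure_tensor M N x' y"
    if "x \<in> carrier M" "x' \<in> carrier M" "y \<in> carrier N" for x x' y
    unfolding defs by (rule add) (use that in \<open>auto simp: tensor_relations_def\<close>)
  show "pure_tensor M N x (y \<oplus>\<^bsub>N\<^esub> y') = pure_tensor M N x y \<oplus>\<^bsub>tensor_product M N\<^esub> pure_tensor M N x y'"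
    if "x \<in> carrier M" "y \<in> carrier N" "y' \<in> carrier N" for x y y'
    unfolding defs by (rule add) (use that in \<open>auto simp: tensor_relations_def\<close>)
  show "pure_tensor M N (c \<odot>\<^bsub>M\<^esub> x) y = c \<odot>\<^bsub>tensor_product M N\<^esub> pure_tensor M N x y"
    if "x \<in> carrier M" "y \<in> carrier N" for c x y
    unfolding defs by (rule scale) (use that in \<open>auto simp: tensor_relations_def\<close>)
  show "pure_tensor M N x (c \<odot>\<^bsub>N\<^esub> y) = c \<odot>\<^bsub>tensor_product M N\<^esub> pure_tensor M N x y"
    if "x \<in> carrier M" "y \<in> carrier N" for c x y
    unfolding defs by (rule scale) (use that in \<open>auto simp: tensor_relations_def\<close>)
qed

lemma module_tensor_product:
  assumes "Module.module rat_field M" "Module.module rat_field N"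
  shows "Module.module rat_field (tensor_product M N)"
  unfolding tensor_product_def by (rule module_rat_presented[OF tensor_relations_carrier[OF assms]])

lemma pure_tensor_carrier:
  assumes "Module.module rat_field M" "Module.module rat_field N" "x \<in> carrier M" "y \<in> carrier N"
  shows "pure_tensor M N x y \<in> carrier (tensor_product M N)"
  unfolding pure_tensor_def tensor_product_def
  by (rule presented_gen_carrier[OF tensor_relations_carrier[OF assms(1,2)]]) (use assms in simp)

text \<open>Tensoring with a fixed element is linear. The Steinberg relations can therefore be
  applied in one factor at a time.\<close>

lemma pure_tensor_preimage:
  assumes M: "Module.module rat_field M" and N: "Module.module rat_field N"
    and P: "submodule P rat_field (tensor_product M N)"
  shows pure_tensor_preimage_left:
      "y \<in> carrier N \<Longrightarrow> submodule {x \<in> carrier M. pure_tensor M N x y \<in> P} rat_field M"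
    and pure_tensor_preimage_right:
      "x \<in> carrier M \<Longrightarrow> submodule {y \<in> carrier N. pure_tensor M N x y \<in> P} rat_field N"
proof -
  note T = module_tensor_product[OF M N]
  note lin = pure_tensor_facts[OF M N]
  note pure = pure_tensor_carrier[OF M N]
  show "submodule {x \<in> carrier M. pure_tensor M N x y \<in> P} rat_field M" if y: "y \<in> carrier N"
  proof (rule submodule_preimage[OF M T P])
    show "pure_tensor M N x y \<in> carrier (tensor_product M N)" if "x \<in> carrier M" for x
      using pure[OF that y] .
    show "pure_tensor M N (x \<oplus>\<^bsub>M\<^esub> x') y =
        pure_tensor M N x y \<oplus>\<^bsub>tensor_product M N\<^esub> pure_tensor M N x' y"
      if "x \<in> carrier M" "x' \<in> carrier M" for x x'
      using lin(1)[OF that y] .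
    show "pure_tensor M N (c \<odot>\<^bsub>M\<^esub> x) y = c \<odot>\<^bsub>tensor_product M N\<^esub> pure_tensor M N x y"
      if "x \<in> carrier M" for c x
      using lin(3)[OF that y] .
  qed
  show "submodule {y \<in> carrier N. pure_tensor M N x y \<in> P} rat_field N" if x: "x \<in> carrier M"
  proof (rule submodule_preimage[OF N T P])
    show "pure_tensor M N x y \<in> carrier (tensor_product M N)" if "y \<in> carrier N" for y
      using pure[OF x that] .
    show "pure_tensor M N x (y \<oplus>\<^bsub>N\<^esub> y') =
        pure_tensor M N x y \<oplus>\<^bsub>tensor_product M N\<^esub> pure_tensor M N x y'"
      if "y \<in> carrier N" "y' \<in> carrier N" for y y'
      using lin(2)[OF x that] .
    show "pure_tensor M N x (c \<odot>\<^bsub>N\<^esub> y) = c \<odot>\<^bsub>tensor_product M N\<^esub> pure_tensor M N x y"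
      if "y \<in> carrier N" for c y
      using lin(4)[OF x that] .
  qed
qed

section \<open>Exchange-closed predicates on tuples\<close>

context finite_dimensional_vector_space
begin

text \<open>Removing a position instead of a vector makes a repeated entry count as a dependence;
  for distinct lists the two removals agree.\<close>

lemma not_independent_tupleI:
  assumes "i < length xs" "xs ! i \<in> span ((!) xs ` ({..<length xs} - {i}))"
  shows "\<not> independent_tuple scale xs"
proof
  assume "independent_tuple scale xs"
  then have d: "distinct xs" and ind: "independent (set xs)"
    by (auto simp: independent_tuple_def)
  have "(!) xs ` ({..<length xs} - {i}) = set xs - {xs ! i}"
    using d assms(1) by (auto simp: set_conv_nth nth_eq_iff_index_eq)
  moreover have "xs ! i \<in> set xs" using assms(1) by simp
  ultimately show False using ind assms(2) unfolding dependent_def by auto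
qed

lemma independent_tuple_mset:
  "mset xs = mset ys \<Longrightarrow> independent_tuple scale xs \<longleftrightarrow> independent_tuple scale ys"
  unfolding independent_tuple_def
  by (metis mset_eq_setD mset_eq_imp_distinct_iff)

lemma independent_tuple_nonzero: "independent_tuple scale xs \<Longrightarrow> 0 \<notin> set xs"
  unfolding independent_tuple_def using dependent_zero by blast

lemma not_independent_tuple_length:
  assumes "set xs \<subseteq> H" "length xs > dim H"
  shows "\<not> independent_tuple scale xs"
  using assms independent_card_le_dim[of "set xs" H] distinct_card[of xs]
  unfolding independent_tuple_def by linarith

text \<open>The trace of the Steinberg relations on membership in a submodule: signs disappear, and
  the last clause is the boundary relation of \<open>xs @ [w]\<close> solved for the face
  \<open>xs\<close>. The parameters \<open>H\<close> and \<open>k\<close> bound only that clause and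
  allow passage to a hyperplane.\<close>

definition steinberg_closed :: "'b set \<Rightarrow> nat \<Rightarrow> ('b list \<Rightarrow> bool) \<Rightarrow> bool" where
  "steinberg_closed H k N \<longleftrightarrow>
     (\<forall>xs ys. mset xs = mset ys \<longrightarrow> N xs \<longrightarrow> N ys) \<and>
     (\<forall>xs. \<not> independent_tuple scale xs \<longrightarrow> N xs) \<and>
     (\<forall>xs w. length xs = k \<longrightarrow> set xs \<subseteq> H \<longrightarrow> w \<in> H \<longrightarrow> w \<noteq> 0 \<longrightarrow>
        (\<forall>j<k. N (xs[j := w])) \<longrightarrow> N xs)"

lemma steinberg_closed_mset:
  "steinberg_closed H k N \<Longrightarrow> N xs \<Longrightarrow> mset xs = mset ys \<Longrightarrow> N ys"
  unfolding steinberg_closed_def by blast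

lemma steinberg_closed_dep:
  "steinberg_closed H k N \<Longrightarrow> \<not> independent_tuple scale xs \<Longrightarrow> N xs"
  unfolding steinberg_closed_def by blast

lemma steinberg_closed_exchange:
  "\<lbrakk>steinberg_closed H k N; length xs = k; set xs \<subseteq> H; w \<in> H; w \<noteq> 0;
    \<And>j. j < k \<Longrightarrow> N (xs[j := w])\<rbrakk> \<Longrightarrow> N xs"
  unfolding steinberg_closed_def by blast

text \<open>Replacing an entry other than \<open>i\<close> and \<open>j\<close> by \<open>w\<close>
  keeps both spanning vectors in place, so the new tuple is dependent and only two terms of the
  exchange remain. The case \<open>i = j\<close> yields invariance under scaling.\<close>

lemma steinberg_closed_three_term:
  assumes N: "steinberg_closed H k N" and xs: "length xs = k" "set xs \<subseteq> H"
    and w: "w \<in> H" "w \<noteq> 0" "w \<in> span {xs ! i, xs ! j}" and ij: "i < k" "j < k"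
    and "N (xs[i := w])" "N (xs[j := w])"
  shows "N xs"
proof (rule steinberg_closed_exchange[OF N xs w(1,2)])
  fix l assume l: "l < k"
  show "N (xs[l := w])"
  proof (cases "l = i \<or> l = j")
    case False
    have "\<not> independent_tuple scale (xs[l := w])"
    proof (rule not_independent_tupleI)
      let ?I = "(!) (xs[l := w]) ` ({..<length (xs[l := w])} - {l})"
      have "xs[l := w] ! i \<in> ?I" "xs[l := w] ! j \<in> ?I"
        using False l ij xs by (auto intro!: imageI)
      then have "{xs ! i, xs ! j} \<subseteq> ?I" using False by simp
      then have "w \<in> span ?I" using w(3) span_mono by blast
      then show "xs[l := w] ! l \<in> span ?I"
        using l xs by simp
    qed (use l xs in simp)
    then show ?thesis by (rule steinberg_closed_dep[OF N])
  qed (use assms in auto)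
qed

lemma steinberg_closed_scale:
  assumes N: "steinberg_closed H k N" and "length (A @ x # B) = k" "set (A @ x # B) \<subseteq> H"
    and "a *s x \<in> H" "a \<noteq> 0" "N (A @ (a *s x) # B)"
  shows "N (A @ x # B)"
proof (cases "x = 0")
  case True
  then show ?thesis
    using independent_tuple_nonzero[of "A @ x # B"] by (intro steinberg_closed_dep[OF N]) auto
next
  case False
  have "a *s x \<in> span {x}" by (intro span_scale span_base) simp
  then show ?thesis
    using assms(2-) False
    by (intro steinberg_closed_three_term[OF N assms(2-4), of "length A" "length A"]) simp_all
qed

section \<open>Paths of difference vectors and their shuffles\<close>

fun differences :: "'b \<Rightarrow> 'b list \<Rightarrow> 'b list" where
  "differences v [] = []"
| "differences v (x # xs) = (x - v) # differences x xs"

text \<open>The second path continues from the end of the first; the \<open>v\<close> inside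
  \<open>last\<close> covers an empty first path.\<close>

lemma differences_append: "differences v (xs @ ys) = differences v xs @ differences (last (v # xs)) ys"
  by (induction v xs rule: differences.induct) auto

lemma length_differences [simp]: "length (differences v xs) = length xs"
  by (induction v xs rule: differences.induct) auto

lemma nth_differences:
  "i < length xs \<Longrightarrow> differences v xs ! i = xs ! i - (if i = 0 then v else xs ! (i - 1))"
proof (induction xs arbitrary: v i)
  case (Cons x xs)
  then show ?case by (cases i) (auto simp: nth_Cons')
qed simp

lemma mset_shuffles: "zs \<in> shuffles xs ys \<Longrightarrow> mset zs = mset xs + mset ys"
  by (induction xs ys arbitrary: zs rule: shuffles.induct) auto

text \<open>Induction along \<open>shuffles\<close>, whose members begin with \<open>x\<close> or
  with \<open>y\<close>. The three-term rule trades one of the edges \<open>x - v\<close> and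
  \<open>y - v\<close> for the edge between \<open>x\<close> and \<open>y\<close>; \<open>R\<close>
  collects the edges already fixed.\<close>

lemma steinberg_closed_shuffle:
  assumes N: "steinberg_closed UNIV k N" and len: "length (R @ xs @ ys @ U) = k"
    and sh: "\<And>zs. zs \<in> shuffles xs ys \<Longrightarrow> N (R @ differences v zs @ U)"
  shows "N (R @ differences v xs @ differences v ys @ U)"
  using len sh
proof (induction xs ys arbitrary: v R rule: shuffles.induct)
  case (3 x xs y ys)
  show ?case
  proof (cases "x = y")
    case True
    \<comment> \<open>Equal first vertices give a repeated edge.\<close>
    then have "\<not> distinct (R @ differences v (x # xs) @ differences v (y # ys) @ U)" by auto
    then show ?thesis
      using steinberg_closed_dep[OF N] unfolding independent_tuple_def by blast
  next
    case False
    \<comment> \<open>Shuffles starting with \<open>x\<close>: both remaining paths now leave from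
      \<open>x\<close>, the second one with the edge from \<open>x\<close> to
      \<open>y\<close>.\<close>
    have "N ((R @ [x - v]) @ differences x xs @ differences x (y # ys) @ U)"
    proof (rule "3.IH"(1))
      fix zs assume "zs \<in> shuffles xs (y # ys)"
      then show "N ((R @ [x - v]) @ differences x zs @ U)" using "3.prems"(2)[of "x # zs"] by simp
    qed (use "3.prems"(1) in simp)
    then have yx: "N ((R @ (x - v) # differences x xs) @ (y - x) # differences y ys @ U)" by simp
    \<comment> \<open>The three-term rule inserts the same vector at either place, so the edge
      \<open>y - x\<close> has to change sign.\<close>
    have 1: "N ((R @ (x - v) # differences x xs) @ (x - y) # differences y ys @ U)"
      by (rule steinberg_closed_scale[OF N, of _ _ _ "-1"]) (use "3.prems" yx in auto)
    \<comment> \<open>Shuffles starting with \<open>y\<close>: reordering puts the edge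
      \<open>x - y\<close> where \<open>x - v\<close> stood.\<close>
    have "N ((R @ [y - v]) @ differences y (x # xs) @ differences y ys @ U)"
    proof (rule "3.IH"(2))
      fix zs assume "zs \<in> shuffles (x # xs) ys"
      then show "N ((R @ [y - v]) @ differences y zs @ U)" using "3.prems"(2)[of "y # zs"] by simp
    qed (use "3.prems"(1) in simp)
    then have 2: "N (R @ (x - y) # differences x xs @ (y - v) # differences y ys @ U)"
      by (rule steinberg_closed_mset[OF N]) simp
    let ?L = "R @ (x - v) # differences x xs @ (y - v) # differences y ys @ U"
    have "(x - v) - (y - v) \<in> span {x - v, y - v}"
      by (intro span_diff span_base) simp_all
    then have sp: "x - y \<in> span {x - v, y - v}" by simp
    have "N ?L"
    proof (rule steinberg_closed_three_term[OF N])
      show "x - y \<noteq> 0" using False by simp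
      show "x - y \<in> span {?L ! length R, ?L ! (length R + Suc (length xs))}"
        using sp by (simp add: nth_append)
      show "N (?L[length R := x - y])" using 2 by (simp add: list_update_append)
      show "N (?L[length R + Suc (length xs) := x - y])"
        using 1 by (simp add: list_update_append)
    qed (use "3.prems"(1) in simp_all)
    then show ?thesis by simp
  qed
qed auto

text \<open>Induction on the number of blocks: shuffling merges the first two blocks of the second
  tuple, and permuting the first tuple restores the correspondence with one block fewer.\<close>

lemma steinberg_closed_paths:
  assumes M1: "\<And>q. steinberg_closed UNIV k (\<lambda>p. M p q)" and M2: "\<And>p. steinberg_closed UNIV k (M p)"
    and base: "\<And>p. length p = k \<Longrightarrow> independent_tuple scale p \<Longrightarrow> M p (differences 0 p)"
    and "length (concat ps) = k" "independent_tuple scale (concat ps)"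
  shows "M (concat ps) (concat (map (differences 0) ps))"
  using assms(4,5)
proof (induction "length ps" arbitrary: ps rule: less_induct)
  case less
  consider "ps = []" | xs where "ps = [xs]" | xs ys us where "ps = xs # ys # us"
    by (metis list.exhaust)
  then show ?case
  proof cases
    case 1
    then show ?thesis using base[of "[]"] less.prems by simp
  next
    case (2 xs)
    then show ?thesis using base[of xs] less.prems by simp
  next
    case (3 xs ys us)
    let ?U = "concat (map (differences 0) us)"
    have lenU: "length ?U = length (concat us)" by (simp add: length_concat comp_def)
    have "M (concat ps) ([] @ differences 0 xs @ differences 0 ys @ ?U)"
    proof (rule steinberg_closed_shuffle[OF M2])
      show "length ([] @ xs @ ys @ ?U) = k" using 3 less.prems lenU by simp
      fix zs assume "zs \<in> shuffles xs ys"
      then have eq: "mset (concat (zs # us)) = mset (concat ps)" using 3 by (simp add: mset_shuffles)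
      have "M (concat (zs # us)) (concat (map (differences 0) (zs # us)))"
        using 3 less.prems independent_tuple_mset[OF eq] mset_eq_length[OF eq]
        by (intro less.hyps) simp_all
      then show "M (concat ps) ([] @ differences 0 zs @ ?U)"
        using steinberg_closed_mset[OF M1 _ eq] by simp
    qed
    then show ?thesis using 3 by simp
  qed
qed

text \<open>Normalised Coxeter pairs: a vector in the span of \<open>last p\<close> and
  \<open>x\<close>, but off the line of \<open>last p\<close>, becomes \<open>x\<close> or
  \<open>x - last p\<close> after rescaling it and \<open>x\<close>. The condition
  \<open>p \<noteq> []\<close> forces the first vectors to agree.\<close>

inductive coxeter_tuples :: "'b list \<Rightarrow> 'b list \<Rightarrow> bool" where
  coxeter_Nil: "coxeter_tuples [] []"
| coxeter_same: "coxeter_tuples p q \<Longrightarrow> coxeter_tuples (p @ [x]) (q @ [x])"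
| coxeter_diff: "coxeter_tuples p q \<Longrightarrow> p \<noteq> [] \<Longrightarrow> coxeter_tuples (p @ [x]) (q @ [x - last p])"

text \<open>\<open>coxeter_same\<close> opens a new block and \<open>coxeter_diff\<close> prolongs
  the last one. Blocks are kept nonempty so that \<open>last p\<close> is the final vertex of the
  last block.\<close>

lemma coxeter_tuples_paths:
  assumes "coxeter_tuples p q"
  shows "\<exists>ps. [] \<notin> set ps \<and> p = concat ps \<and> q = concat (map (differences 0) ps)"
  using assms
proof induction
  case coxeter_Nil
  show ?case by (rule exI[of _ "[]"]) simp
next
  case (coxeter_same p q x)
  then obtain ps where "[] \<notin> set ps" "p = concat ps" "q = concat (map (differences 0) ps)" by blast
  then show ?case by (intro exI[of _ "ps @ [[x]]"]) simp
next
  case (coxeter_diff p q x)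
  then obtain ps where ps: "[] \<notin> set ps" "p = concat ps" "q = concat (map (differences 0) ps)" by blast
  with coxeter_diff have "ps \<noteq> []" by auto
  then obtain qs r where qs: "ps = qs @ [r]" by (cases ps rule: rev_cases) auto
  with ps have "r \<noteq> []" by auto
  then show ?case using ps qs
    by (intro exI[of _ "qs @ [r @ [x]]"]) (auto simp: differences_append)
qed

text \<open>Induction on the number of entries outside \<open>F\<close>. Two such entries have a
  combination in \<open>F\<close> that can replace either of them; a single one is moved to the end;
  with none, the tuple is too long for \<open>F\<close> to be independent.\<close>

lemma steinberg_closed_hyperplane:
  assumes N: "steinberg_closed H (Suc k) N"
    and H: "subspace H" and F: "subspace F" "F \<subseteq> H" "dim F = k" and l: "H \<subseteq> span (insert l F)"
    and base: "\<And>y q. \<lbrakk>length y = k; set y \<subseteq> F; q \<in> H; q \<notin> F\<rbrakk> \<Longrightarrow> N (y @ [q])"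
    and "length xs = Suc k" "set xs \<subseteq> H"
  shows "N xs"
  using assms(8,9)
proof (induction "card {i. i < length xs \<and> xs ! i \<notin> F}" arbitrary: xs rule: less_induct)
  case less
  let ?I = "\<lambda>xs. {i. i < length xs \<and> xs ! i \<notin> F}"
  show ?case
  proof (cases "set xs \<subseteq> F")
    case True
    then show ?thesis
      using not_independent_tuple_length[of xs F] F less.prems
      by (intro steinberg_closed_dep[OF N]) auto
  next
    case False
    then obtain i where i: "i < length xs" "xs ! i \<notin> F" by (metis in_set_conv_nth subsetI)
    show ?thesis
    proof (cases "\<exists>j\<in>?I xs. j \<noteq> i")
      case True
      then obtain j where j: "j < length xs" "xs ! j \<notin> F" "j \<noteq> i" by auto
      have smaller: "N (xs[m := w])" if "m \<in> ?I xs" "w \<in> F" for m w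
      proof (rule less.hyps)
        have "?I (xs[m := w]) = ?I xs - {m}"
          using that by (auto simp: nth_list_update)
        then show "card (?I (xs[m := w])) < card (?I xs)"
          using that(1) by (simp only:) (rule card_Diff1_less, simp_all)
        show "set (xs[m := w]) \<subseteq> H"
          using set_update_subset_insert[of xs m w] less.prems that F by auto
      qed (use less.prems in simp)
      \<comment> \<open>Here \<open>c\<close> is the coordinate of \<open>x\<close> along
        \<open>l\<close> modulo \<open>F\<close>.\<close>
      have coord: "\<exists>c. x - c *s l \<in> F" if "x \<in> H" for x
      proof -
        have "x \<in> span (insert l F)" using that l by blast
        then show ?thesis using F(1) by (simp add: span_breakdown_eq span_eq_iff[THEN iffD2])
      qed
      have ijH: "xs ! i \<in> H" "xs ! j \<in> H" using i j less.prems by auto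
      obtain a b where ab: "xs ! i - a *s l \<in> F" "xs ! j - b *s l \<in> F"
        using coord ijH by blast
      then have b0: "b \<noteq> 0" using j by auto
      \<comment> \<open>The factor \<open>a / b\<close> cancels the coordinates along
        \<open>l\<close>, so the combination falls into \<open>F\<close>.\<close>
      let ?w = "xs ! i - (a / b) *s xs ! j"
      have "?w = (xs ! i - a *s l) - (a / b) *s (xs ! j - b *s l)"
        using b0 by (simp add: scale_right_diff_distrib)
      then have wF: "?w \<in> F" using ab F(1) by (metis subspace_diff subspace_scale)
      have sp: "?w \<in> span {xs ! i, xs ! j}" by (intro span_diff span_scale span_base) auto
      show ?thesis
      proof (cases "?w = 0")
        case True
        \<comment> \<open>In this case entry \<open>i\<close> is a multiple of entry
          \<open>j\<close>.\<close>
        have "xs ! j \<in> (!) xs ` ({..<length xs} - {i})" using j by auto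
        then have "(a / b) *s xs ! j \<in> span ((!) xs ` ({..<length xs} - {i}))"
          by (intro span_scale span_base)
        then have "\<not> independent_tuple scale xs"
          using True i by (intro not_independent_tupleI[of i]) auto
        then show ?thesis by (rule steinberg_closed_dep[OF N])
      next
        case False
        show ?thesis
          by (rule steinberg_closed_three_term[OF N less.prems _ False sp])
            (use wF F i j smaller less.prems in auto)
      qed
    next
      case False
      \<comment> \<open>Only entry \<open>i\<close> lies outside \<open>F\<close>; deleting it moves
        every later position down by one.\<close>
      obtain A B x where AB: "xs = A @ x # B" "length A = i"
        using i(1) id_take_nth_drop[OF i(1)] by (metis length_take min.absorb4)
      have "(A @ B) ! m \<in> F" if "m < length (A @ B)" for m
      proof (cases "m < i")
        case True
        then have "m \<notin> ?I xs" using False by auto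
        then show ?thesis using True AB by (simp add: nth_append)
      next
        case m: False
        then have "Suc m \<notin> ?I xs" using False by auto
        then show ?thesis using m that AB by (simp add: nth_append Suc_diff_le)
      qed
      then have "set (A @ B) \<subseteq> F" by (metis in_set_conv_nth subsetI)
      then have "N ((A @ B) @ [x])"
        using i less.prems AB by (intro base) auto
      then show ?thesis by (rule steinberg_closed_mset[OF N]) (simp add: AB)
    qed
  qed
qed

section \<open>Induction on the dimension\<close>

lemma independent_tuple_snoc:
  "independent_tuple scale (xs @ [l]) \<longleftrightarrow> independent_tuple scale xs \<and> l \<notin> span (set xs)"
proof (cases "l \<in> set xs")
  case True
  then show ?thesis using span_base[OF True] by (simp add: independent_tuple_def)
next
  case False
  then show ?thesis unfolding independent_tuple_def by (simp add: independent_insert conj_ac)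
qed

text \<open>An exchange on \<open>xs @ [l]\<close> has one term more than an exchange on
  \<open>xs\<close>, the one that replaces \<open>l\<close>; it has more than \<open>dim F\<close>
  entries, all in \<open>F\<close>, and is dependent.\<close>

lemma steinberg_closed_snoc:
  assumes N: "steinberg_closed H (Suc k) N" and F: "F \<subseteq> H" "dim F = k" and l: "l \<in> H"
  shows "steinberg_closed F k (\<lambda>xs. N (xs @ [l]))"
  unfolding steinberg_closed_def
proof (intro conjI allI impI)
  fix xs ys :: "'b list" assume "mset xs = mset ys" "N (xs @ [l])"
  then show "N (ys @ [l])" using steinberg_closed_mset[OF N, of "xs @ [l]" "ys @ [l]"] by simp
next
  fix xs assume "\<not> independent_tuple scale xs"
  then have "\<not> independent_tuple scale (xs @ [l])" by (simp add: independent_tuple_snoc)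
  then show "N (xs @ [l])" by (rule steinberg_closed_dep[OF N])
next
  fix xs w
  assume xs: "length xs = k" "set xs \<subseteq> F" "w \<in> F" "w \<noteq> 0" and ex: "\<forall>j<k. N (xs[j := w] @ [l])"
  show "N (xs @ [l])"
  proof (rule steinberg_closed_exchange[OF N])
    fix j assume "j < Suc k"
    show "N ((xs @ [l])[j := w])"
    proof (cases "j < k")
      case True
      then show ?thesis using ex xs(1) by (simp add: list_update_append)
    next
      case False
      then have "(xs @ [l])[j := w] = xs @ [w]" using xs(1) \<open>j < Suc k\<close>
        by (simp add: less_Suc_eq list_update_append)
      moreover have "\<not> independent_tuple scale (xs @ [w])"
        by (rule not_independent_tuple_length[of _ F]) (use xs F in auto)
      ultimately show ?thesis using steinberg_closed_dep[OF N] by simp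
    qed
  qed (use xs F l in auto)
qed

text \<open>Prescribing the last vector drives the induction: the pair obtained in the hyperplane
  must end in the very vector that is subtracted from the new one. Hence \<open>H\<close>,
  \<open>M\<close> and \<open>l\<close> all vary.\<close>

lemma steinberg_closed_coxeter:
  assumes "subspace H" "dim H = k"
    and "\<And>q. steinberg_closed H k (\<lambda>p. M p q)" "\<And>p. steinberg_closed H k (M p)"
    and "0 < k \<Longrightarrow> l \<in> H \<and> l \<noteq> 0"
    and "\<And>p q. \<lbrakk>coxeter_tuples p q; length p = k; set p \<subseteq> H; independent_tuple scale p;
      p \<noteq> [] \<Longrightarrow> last p = l\<rbrakk> \<Longrightarrow> M p q"
    and "length p = k" "set p \<subseteq> H" "length q = k" "set q \<subseteq> H"
  shows "M p q"
  using assms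
proof (induction k arbitrary: H M l p q)
  case 0
  then show ?case using coxeter_Nil by (simp add: independent_tuple_def independent_empty)
next
  case (Suc k)
  note H = Suc.prems(1,2) and M1 = Suc.prems(3) and M2 = Suc.prems(4)
    and base = Suc.prems(6) and p = Suc.prems(7,8) and q = Suc.prems(9,10)
  have l: "l \<in> H" "l \<noteq> 0" using Suc.prems(5) by auto
  have last_l: "M (x @ [l]) q" if x: "length x = k" "set x \<subseteq> H" for x
  proof (cases "independent_tuple scale (x @ [l])")
    case False
    then show ?thesis by (rule steinberg_closed_dep[OF M1])
  next
    case True
    define F where "F = span (set x)"
    have ind: "independent (set x)" "distinct x" and lF: "l \<notin> F"
      using True[unfolded independent_tuple_snoc] by (simp_all add: independent_tuple_def F_def)
    have F: "subspace F" "F \<subseteq> H" "dim F = k" "set x \<subseteq> F"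
      using ind x H(1) by (auto simp: F_def dim_eq_card_independent distinct_card
          span_minimal[THEN subsetD] span_base)
    have "H \<subseteq> span (insert l (set x))"
    proof (rule card_ge_dim_independent)
      show "independent (insert l (set x))" using True by (auto simp: independent_tuple_def)
      have "card (insert l (set x)) = Suc k"
        using distinct_card[of "x @ [l]"] True x by (simp add: independent_tuple_def)
      then show "dim H \<le> card (insert l (set x))" using H by simp
    qed (use x l in auto)
    also have "\<dots> \<subseteq> span (insert l F)" using F by (intro span_mono) auto
    finally have HF: "H \<subseteq> span (insert l F)" .
    show ?thesis
    proof (rule steinberg_closed_hyperplane[OF M2 H(1) F(1-3) HF _ q])
      fix y r assume y: "length y = k" "set y \<subseteq> F" and r: "r \<in> H" "r \<notin> F"
      obtain c where c: "r - c *s l \<in> F"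
        using r(1) HF F(1) by (force simp: span_breakdown_eq span_eq_iff[THEN iffD2])
      then have c0: "c \<noteq> 0" using r by auto
      \<comment> \<open>Rescaling \<open>r\<close> to coordinate one along \<open>l\<close> gives
        \<open>z = l - w\<close> with \<open>w\<close> in \<open>F\<close>.\<close>
      define w where "w = l - (1 / c) *s r"
      define z where "z = (1 / c) *s r"
      have "w = - ((1 / c) *s (r - c *s l))"
        using c0 by (simp add: w_def scale_right_diff_distrib)
      then have wF: "w \<in> F" using c F(1) by (simp add: subspace_neg subspace_scale)
      have zw: "z = l - w" by (simp add: z_def w_def)
      have zH: "z \<in> H" using r H(1) by (simp add: z_def subspace_scale)
      have "M (x @ [l]) (y @ [z])"
      \<comment> \<open>A nonzero \<open>w\<close> is prescribed as last vector, ready for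
        \<open>coxeter_diff\<close>. If \<open>w = 0\<close>, then \<open>z = l\<close>,
        \<open>coxeter_same\<close> applies, and any nonzero vector of \<open>F\<close> will do;
        \<open>hd x\<close> is one when \<open>k\<close> is positive.\<close>
      proof (rule Suc.IH[of F "\<lambda>x y. M (x @ [l]) (y @ [z])" "if w \<noteq> 0 then w else hd x" x y])
        show "steinberg_closed F k (\<lambda>p. M (p @ [l]) (q @ [z]))" for q
          by (rule steinberg_closed_snoc[OF M1 F(2,3) l(1)])
        show "steinberg_closed F k (\<lambda>q. M (p @ [l]) (q @ [z]))" for p
          by (rule steinberg_closed_snoc[OF M2 F(2,3) zH])
        show "(if w \<noteq> 0 then w else hd x) \<in> F \<and> (if w \<noteq> 0 then w else hd x) \<noteq> 0" if "0 < k"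
        proof -
          have "hd x \<in> set x" using that x(1) by auto
          then show ?thesis using wF F(4) ind(1) dependent_zero by auto
        qed
      next
        fix p' q'
        assume *: "coxeter_tuples p' q'" "length p' = k" "set p' \<subseteq> F" "independent_tuple scale p'"
          "p' \<noteq> [] \<Longrightarrow> last p' = (if w \<noteq> 0 then w else hd x)"
        have "span (set p') \<subseteq> F" using *(3) F(1) by (rule span_minimal)
        then have ind': "independent_tuple scale (p' @ [l])"
          using * lF by (auto simp: independent_tuple_snoc)
        have "coxeter_tuples (p' @ [l]) (q' @ [z])"
        proof (cases "w = 0")
          case True
          then show ?thesis using coxeter_same[OF *(1)] zw by simp
        next
          case False
          \<comment> \<open>An empty \<open>p'\<close> means \<open>k = 0\<close>, so
            \<open>F\<close> is the zero space and \<open>w\<close> would vanish.\<close>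
          have "p' \<noteq> []"
          proof
            assume "p' = []"
            then have "x = []" using * x by simp
            then show False using wF \<open>w \<noteq> 0\<close> by (simp add: F_def)
          qed
          then show ?thesis using coxeter_diff[OF *(1), of l] zw *(5) False by simp
        qed
        then show "M (p' @ [l]) (q' @ [z])"
          using * ind' l F(2) by (intro base) auto
      qed (use F x y in auto)
      then show "M (x @ [l]) (y @ [r])"
        using y r F zH c0 by (intro steinberg_closed_scale[OF M2, of y r "[]" "1 / c"]) (auto simp: z_def)
    qed
  qed
  \<comment> \<open>Exchange against \<open>l\<close>: every term contains \<open>l\<close>, and
    moving it to the end gives the case already settled.\<close>
  show ?case
  proof (rule steinberg_closed_exchange[OF M1 p l])
    fix j assume j: "j < Suc k"
    have "set (take j p @ drop (Suc j) p) \<subseteq> H"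
      using p set_take_subset[of j p] set_drop_subset[of "Suc j" p] by auto
    then have "M ((take j p @ drop (Suc j) p) @ [l]) q"
      using j p by (intro last_l) auto
    then show "M (p[j := l]) q"
      using j p by (rule_tac steinberg_closed_mset[OF M1]) (auto simp: upd_conv_take_nth_drop)
  qed
qed

text \<open>Partial sums of the differences recover \<open>p\<close>, so the second simplex spans
  too. If a later line agreed with its counterpart, \<open>p ! (i - 1)\<close> would be a multiple
  of \<open>p ! i\<close>.\<close>

lemma generic_coxeter_pair_differences:
  assumes p: "length p = dim UNIV" "independent_tuple scale p"
  shows "generic_coxeter_pair scale (map (\<lambda>v. span {v}) p) (map (\<lambda>v. span {v}) (differences 0 p))"
proof -
  let ?q = "differences 0 p"
  have ind: "independent (set p)" and dist: "distinct p"
    using p by (auto simp: independent_tuple_def)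
  have span_lines: "span (\<Union>(set (map (\<lambda>v. span {v}) r))) = span (set r)" for r
  proof (rule antisym)
    have "span {v} \<subseteq> span (set r)" if "v \<in> set r" for v using that by (intro span_mono) auto
    then show "span (\<Union>(set (map (\<lambda>v. span {v}) r))) \<subseteq> span (set r)"
      by (intro span_minimal) auto
    show "span (set r) \<subseteq> span (\<Union>(set (map (\<lambda>v. span {v}) r)))"
      by (intro span_mono) (auto intro: span_base)
  qed
  have spp: "span (set p) = UNIV"
    using card_ge_dim_independent[of "set p" UNIV] ind p(1) dist by (auto simp: distinct_card)
  have mem: "p ! i \<in> span (set ?q)" if "i < length p" for i
    using that
  proof (induction i)
    case 0
    then have "?q ! 0 \<in> set ?q" by (intro nth_mem) simp
    then show ?case using 0 by (simp add: nth_differences span_base)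
  next
    case (Suc i)
    then have "?q ! Suc i \<in> set ?q" by (intro nth_mem) simp
    then have "p ! Suc i - p ! i \<in> span (set ?q)" using Suc by (simp add: nth_differences span_base)
    from span_add[OF this Suc.IH] show ?case using Suc by simp
  qed
  then have "span (set p) \<subseteq> span (set ?q)"
    by (intro span_minimal) (auto simp: in_set_conv_nth)
  then have spq: "span (set ?q) = UNIV" using spp by auto
  have p0: "p ! i \<noteq> 0" if "i < length p" for i
    using that independent_tuple_nonzero[OF p(2)] by (metis nth_mem)
  have not_span: "p ! i \<notin> span {p ! i - p ! (i - 1)}" if i: "0 < i" "i < length p" for i
  proof
    assume "p ! i \<in> span {p ! i - p ! (i - 1)}"
    then obtain c where c: "p ! i = c *s (p ! i - p ! (i - 1))" by (auto simp: span_singleton)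
    then have "c \<noteq> 0" using p0[OF i(2)] by auto
    then have "p ! i - p ! (i - 1) = (1 / c) *s p ! i" using c
      by (metis divide_self_if mult.commute scale_one scale_scale times_divide_eq_left)
    then have "p ! (i - 1) = (1 - 1 / c) *s p ! i" by (simp add: scale_left_diff_distrib algebra_simps)
    moreover have "p ! i \<in> (!) p ` ({..<length p} - {i - 1})" using i by auto
    ultimately have "p ! (i - 1) \<in> span ((!) p ` ({..<length p} - {i - 1}))"
      by (simp add: span_scale span_base)
    then show False using not_independent_tupleI[of "i - 1" p] i p(2) less_imp_diff_less by blast
  qed
  \<comment> \<open>For \<open>i = 0\<close> the difference is \<open>p ! 0\<close> itself;
    otherwise its vanishing would make two neighbours equal.\<close>
  have q0: "?q ! i \<noteq> 0" if "i < length p" for i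
  proof
    assume "?q ! i = 0"
    then show False using that p0[OF that] dist
      by (auto simp: nth_differences nth_eq_iff_index_eq split: if_splits)
  qed
  have lines: "projective_simplex scale (map (\<lambda>v. span {v}) r)"
    if "length r = dim UNIV" "\<And>i. i < length r \<Longrightarrow> r ! i \<noteq> 0" for r
  proof -
    have "0 \<notin> set r" using that(2) by (auto simp: in_set_conv_nth)
    then have "is_line scale (span {v})" if "v \<in> set r" for v
      using that unfolding is_line_def by metis
    then show ?thesis using that(1) by (simp add: projective_simplex_def)
  qed
  have "?q ! i \<in> span (span {p ! (i - 1)} \<union> span {p ! i})" if "0 < i" "i < length p" for i
    using that by (auto simp: nth_differences intro!: span_diff) (auto intro!: span_base)
  then have incl: "span {?q ! i} \<subseteq> span (span {p ! (i - 1)} \<union> span {p ! i})"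
    if "0 < i" "i < length p" for i
    using that by (intro span_minimal) auto
  have "span {p ! i} \<noteq> span {?q ! i}" if "0 < i" "i < length p" for i
    using not_span[OF that] that span_base[of "p ! i" "{p ! i}"] by (auto simp: nth_differences)
  then show ?thesis
    unfolding generic_coxeter_pair_def coxeter_pair_def nondegenerate_def span_lines
    using lines[OF p(1) p0] lines[of ?q] q0 p(1) spp spq incl
    by (simp add: nth_differences less_imp_diff_less)
qed

text \<open>Joins the two reductions: arbitrary pairs to Coxeter tuples, and these to a single
  path.\<close>

lemma steinberg_closed_all:
  assumes M1: "\<And>q. steinberg_closed UNIV (dim UNIV) (\<lambda>p. M p q)"
    and M2: "\<And>p. steinberg_closed UNIV (dim UNIV) (M p)"
    and base: "\<And>p. length p = dim UNIV \<Longrightarrow> independent_tuple scale p \<Longrightarrow> M p (differences 0 p)"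
    and "length p = dim UNIV" "length q = dim UNIV"
  shows "M p q"
proof -
  obtain l :: 'b where l: "l \<noteq> 0" if "0 < dim UNIV"
  proof (cases "\<exists>l::'b. l \<noteq> 0")
    \<comment> \<open>In dimension zero the condition on \<open>l\<close> is vacuous, and
      \<open>0\<close> is a placeholder.\<close>
    case False
    then have "UNIV = {0::'b}" by blast
    then have "dim UNIV = 0" using dim_span[of "{}"] by (simp add: span_empty dim_eq_0)
    then show ?thesis using that[of 0] by simp
  qed (use that in blast)
  show ?thesis
  proof (rule steinberg_closed_coxeter[where H = UNIV and l = l, OF _ refl M1 M2])
    fix p q assume *: "coxeter_tuples p q" "length p = dim UNIV" "independent_tuple scale p"
    then obtain ps where "p = concat ps" "q = concat (map (differences 0) ps)"
      using coxeter_tuples_paths by blast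
    then show "M p q" using steinberg_closed_paths[of "dim UNIV" M ps] M1 M2 base * by simp
  qed (use assms l in auto)
qed

section \<open>Submodules of the Steinberg module\<close>

lemma steinberg_relation_intros:
  shows steinberg_relation_dependent: "\<lbrakk>vs \<in> nonzero_tuples (dim UNIV); \<not> independent_tuple scale vs\<rbrakk> \<Longrightarrow>
      free_gen vs \<in> steinberg_relations scale"
    and steinberg_relation_permute: "\<lbrakk>vs \<in> nonzero_tuples (dim UNIV); \<sigma> permutes {..<dim UNIV}\<rbrakk> \<Longrightarrow>
      free_gen (permute_list \<sigma> vs) - Poly_Mapping.single vs (of_int (sign \<sigma>)) \<in> steinberg_relations scale"
    and steinberg_relation_scale: "\<lbrakk>vs \<in> nonzero_tuples (dim UNIV); i < dim UNIV; a \<noteq> 0\<rbrakk> \<Longrightarrow>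
      free_gen (vs[i := a *s (vs ! i)]) - free_gen vs \<in> steinberg_relations scale"
    and steinberg_relation_boundary: "us \<in> nonzero_tuples (Suc (dim UNIV)) \<Longrightarrow>
      (\<Sum>i\<le>dim UNIV. Poly_Mapping.single (take i us @ drop (Suc i) us) ((-1) ^ i)) \<in> steinberg_relations scale"
  unfolding steinberg_relations_def Let_def by blast+

lemma steinberg_relations_carrier:
  "steinberg_relations scale \<subseteq> carrier (free_rat_module (nonzero_tuples (dim UNIV)))" (is "_ \<subseteq> ?C")
proof
  let ?S = "nonzero_tuples (dim UNIV) :: 'b list set"
  note C = Module.module.carrier_is_submodule[OF module_free_rat_module, of ?S]
  have single: "Poly_Mapping.single vs c \<in> ?C" if "vs \<in> ?S" for vs c
    using that by simp
  have diff: "free_gen vs - Poly_Mapping.single ws c \<in> ?C" if "vs \<in> ?S" "ws \<in> ?S" for vs ws c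
    by (rule free_rat_submodule_diff[OF C single[OF that(1)] single[OF that(2)]])
  fix r assume "r \<in> steinberg_relations scale"
  then consider
      vs where "r = free_gen vs" "vs \<in> ?S"
    | \<sigma> vs where "r = free_gen (permute_list \<sigma> vs) - Poly_Mapping.single vs (of_int (sign \<sigma>))"
        "vs \<in> ?S" "\<sigma> permutes {..<dim UNIV}"
    | vs i a where "r = free_gen (vs[i := a *s (vs ! i)]) - free_gen vs" "vs \<in> ?S" "i < dim UNIV" "a \<noteq> 0"
    | vs where "r = (\<Sum>i\<le>dim UNIV. Poly_Mapping.single (take i vs @ drop (Suc i) vs) ((-1) ^ i))"
        "vs \<in> nonzero_tuples (Suc (dim UNIV))"
    unfolding steinberg_relations_def Let_def by blast
  then show "r \<in> ?C"
  proof cases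
    case 1
    then show ?thesis by simp
  next
    case (2 \<sigma> vs)
    then have "permute_list \<sigma> vs \<in> ?S" by (simp add: nonzero_tuples_def)
    then show ?thesis unfolding 2(1) using 2(2) by (rule diff)
  next
    case (3 vs i a)
    then have "vs ! i \<noteq> 0" by (metis (mono_tags, lifting) mem_Collect_eq nonzero_tuples_def nth_mem)
    then have "vs[i := a *s (vs ! i)] \<in> ?S"
      using 3 set_update_subset_insert[of vs i "a *s (vs ! i)"] by (auto simp: nonzero_tuples_def)
    then show ?thesis unfolding 3(1) using 3(2) by (rule diff)
  next
    case (4 vs)
    have "take i vs @ drop (Suc i) vs \<in> ?S" if "i \<le> dim UNIV" for i
      using 4(2) that by (auto simp: nonzero_tuples_def dest: in_set_takeD in_set_dropD)
    then show ?thesis unfolding 4(1) by (intro free_rat_submodule_sum[OF C] single) simp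
  qed
qed

lemma module_steinberg: "Module.module rat_field (steinberg scale)"
  unfolding steinberg_def by (rule module_rat_presented[OF steinberg_relations_carrier])

lemma apartment_carrier:
  "vs \<in> nonzero_tuples (dim UNIV) \<Longrightarrow> apartment scale vs \<in> carrier (steinberg scale)"
  unfolding steinberg_def apartment_def by (rule presented_gen_carrier[OF steinberg_relations_carrier])

text \<open>The prefix \<open>us\<close> is arbitrary so that the induction can rescale one entry at
  a time behind entries already changed.\<close>

lemma apartment_scale_entries:
  assumes "list_all2 (\<lambda>x y. \<exists>a. a \<noteq> 0 \<and> y = a *s x) xs ys" and "us @ xs \<in> nonzero_tuples (dim UNIV)"
  shows "apartment scale (us @ ys) = apartment scale (us @ xs)"
  using assms
proof (induction xs ys arbitrary: us rule: list_all2_induct)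
  case (Cons x xs y ys)
  then obtain a where a: "a \<noteq> 0" "y = a *s x" by blast
  have S: "us @ y # xs \<in> nonzero_tuples (dim UNIV)"
    using Cons.prems a by (auto simp: nonzero_tuples_def)
  have "apartment scale (us @ y # ys) = apartment scale (us @ y # xs)"
    using Cons.IH[of "us @ [y]"] S by simp
  also have "\<dots> = apartment scale (us @ x # xs)"
    unfolding apartment_def
  proof (rule presented_gen_eqI[OF steinberg_relations_carrier _ S Cons.prems])
    have "us @ y # xs = (us @ x # xs)[length us := a *s ((us @ x # xs) ! length us)]"
      using a by simp
    moreover have "length us < dim UNIV" using Cons.prems by (simp add: nonzero_tuples_def)
    ultimately show "free_gen (us @ y # xs) - free_gen (us @ x # xs) \<in> steinberg_relations scale"
      using steinberg_relation_scale[OF Cons.prems _ a(1)] by metis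
  qed
  finally show ?case .
qed simp

text \<open>Frees \<open>simplex_class\<close> from the choice operator: the chosen generator
  differs from \<open>v\<close> only by a unit, which apartments do not see.\<close>

lemma line_generator_span:
  assumes "v \<noteq> 0"
  shows "\<exists>a. a \<noteq> 0 \<and> line_generator scale (span {v}) = a *s v"
proof -
  have "line_generator scale (span {v}) \<noteq> 0 \<and> span {v} = span {line_generator scale (span {v})}"
    unfolding line_generator_def by (rule someI[of _ v]) (use assms in simp)
  moreover from this have "line_generator scale (span {v}) \<in> span {v}" by (metis insertI1 span_base)
  then obtain a where "line_generator scale (span {v}) = a *s v" by (auto simp: span_singleton)
  ultimately show ?thesis by (metis scale_zero_left)
qed

lemma simplex_class_lines:
  assumes "vs \<in> nonzero_tuples (dim UNIV)"
  shows "simplex_class scale (map (\<lambda>v. span {v}) vs) = apartment scale vs"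
proof -
  have "list_all2 (\<lambda>x y. \<exists>a. a \<noteq> 0 \<and> y = a *s x) vs (map (line_generator scale) (map (\<lambda>v. span {v}) vs))"
    using assms line_generator_span by (auto simp: nonzero_tuples_def list_all2_conv_all_nth in_set_conv_nth)
  from apartment_scale_entries[OF this, of "[]"] show ?thesis
    using assms by (simp add: simplex_class_def)
qed

text \<open>The guards make the clause on dependent tuples vacuous. Skew symmetry gives the
  permutation clause and the boundary relation the exchange clause.\<close>

lemma steinberg_submodule_closed:
  assumes U: "submodule U rat_field (free_rat_module (nonzero_tuples (dim UNIV)))"
    and rel: "steinberg_relations scale \<subseteq> U"
  shows "steinberg_closed UNIV (dim UNIV)
    (\<lambda>vs. length vs = dim UNIV \<longrightarrow> independent_tuple scale vs \<longrightarrow> free_gen vs \<in> U)"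
    (is "steinberg_closed UNIV ?d _")
  unfolding steinberg_closed_def
proof (intro conjI allI impI)
  \<comment> \<open>The sign of a permutation is a nonzero scalar, so the skew-symmetry relation
    carries membership over to any reordering.\<close>
  have perm: "free_gen ys \<in> U"
    if eq: "mset xs = mset ys" and xsU: "free_gen xs \<in> U" and ys: "ys \<in> nonzero_tuples ?d" for xs ys :: "'b list"
  proof -
    obtain \<sigma> where \<sigma>: "\<sigma> permutes {..<length ys}" "permute_list \<sigma> ys = xs"
      using mset_eq_permutation[OF eq] by blast
    have "length ys = ?d" using ys by (simp add: nonzero_tuples_def)
    then have "free_gen xs - Poly_Mapping.single ys (of_int (sign \<sigma>)) \<in> U"
      using steinberg_relation_permute[OF ys, of \<sigma>] \<sigma>(1) rel unfolding \<sigma>(2) by auto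
    from free_rat_submodule_diff[OF U xsU this]
    have "Poly_Mapping.single ys (of_int (sign \<sigma>)) \<in> U" by simp
    then show ?thesis
      by (subst (asm) free_rat_submodule_single_iff[OF U]) (simp_all add: sign_def)
  qed
  {
    fix xs ys :: "'b list"
    assume eq: "mset xs = mset ys" and xs: "length xs = ?d \<longrightarrow> independent_tuple scale xs \<longrightarrow> free_gen xs \<in> U"
      and ys: "length ys = ?d" "independent_tuple scale ys"
    have "free_gen xs \<in> U"
      using xs ys independent_tuple_mset[OF eq] mset_eq_length[OF eq] by simp
    then show "free_gen ys \<in> U"
      by (rule perm[OF eq]) (use ys independent_tuple_nonzero in \<open>simp add: nonzero_tuples_def\<close>)
  }
  fix xs w
  assume xs: "length xs = ?d" "independent_tuple scale xs" and w: "w \<noteq> 0"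
    and ex: "\<forall>j<?d. length (xs[j := w]) = ?d \<longrightarrow> independent_tuple scale (xs[j := w]) \<longrightarrow> free_gen (xs[j := w]) \<in> U"
  \<comment> \<open>In the boundary of \<open>xs @ [w]\<close>, omitting \<open>w\<close> leaves
    \<open>xs\<close>, and omitting entry \<open>i\<close> leaves \<open>xs[i := w]\<close> up to
    order.\<close>
  let ?v = "xs @ [w]"
  let ?f = "\<lambda>i. Poly_Mapping.single (take i ?v @ drop (Suc i) ?v) ((-1) ^ i) :: 'b list \<Rightarrow>\<^sub>0 rat"
  have xs0: "0 \<notin> set xs" using xs independent_tuple_nonzero by blast
  have "?v \<in> nonzero_tuples (Suc ?d)" using xs(1) xs0 w by (simp add: nonzero_tuples_def)
  then have sum: "(\<Sum>i\<le>?d. ?f i) \<in> U"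
    using steinberg_relation_boundary rel by blast
  have "?f i \<in> U" if i: "i < ?d" for i
  proof -
    let ?y = "take i xs @ drop (Suc i) xs @ [w]"
    have S: "?y \<in> nonzero_tuples ?d"
      using i xs(1) xs0 w by (auto simp: nonzero_tuples_def dest: in_set_takeD in_set_dropD)
    have eq: "mset (xs[i := w]) = mset ?y" using i xs(1) by (simp add: upd_conv_take_nth_drop)
    have "free_gen ?y \<in> U"
    proof (cases "independent_tuple scale ?y")
      case True
      then have "free_gen (xs[i := w]) \<in> U"
        using ex i xs(1) independent_tuple_mset[OF eq] by simp
      then show ?thesis by (rule perm[OF eq _ S])
    next
      case False
      then show ?thesis using steinberg_relation_dependent[OF S] rel by blast
    qed
    then show ?thesis using i xs(1) free_rat_submodule_single[OF U, of ?y] by simp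
  qed
  \<comment> \<open>Subtracting the faces that contain \<open>w\<close> isolates the face
    \<open>xs\<close>, whose coefficient is a sign.\<close>
  then have "(\<Sum>i<?d. ?f i) \<in> U" by (intro free_rat_submodule_sum[OF U]) simp
  from free_rat_submodule_diff[OF U sum this] have "?f ?d \<in> U"
    by (simp add: lessThan_Suc_atMost[symmetric])
  then have "Poly_Mapping.single xs ((-1) ^ ?d) \<in> U" using xs(1) by simp
  then show "free_gen xs \<in> U" by (subst (asm) free_rat_submodule_single_iff[OF U]) simp_all
qed simp

text \<open>Both parts pass to the preimage of \<open>Q\<close> in the free module. Dependent tuples
  are relations there, so independent ones decide whether \<open>Q\<close> is everything.\<close>

lemma steinberg_submodule:
  assumes Q: "submodule Q rat_field (steinberg scale)"
  shows steinberg_closed_apartment: "steinberg_closed UNIV (dim UNIV)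
      (\<lambda>vs. length vs = dim UNIV \<longrightarrow> independent_tuple scale vs \<longrightarrow> apartment scale vs \<in> Q)"
    and steinberg_submodule_eq_carrier:
      "(\<And>vs. \<lbrakk>length vs = dim UNIV; independent_tuple scale vs\<rbrakk> \<Longrightarrow> apartment scale vs \<in> Q) \<Longrightarrow>
        Q = carrier (steinberg scale)"
proof -
  let ?S = "nonzero_tuples (dim UNIV) :: 'b list set"
  let ?U = "{f \<in> carrier (free_rat_module ?S). presented_class ?S (steinberg_relations scale) f \<in> Q}"
  note Rel = steinberg_relations_carrier
  note Q' = Q[unfolded steinberg_def]
  note U = presented_class_preimage[OF Rel Q']
  have mem: "free_gen vs \<in> ?U \<longleftrightarrow> apartment scale vs \<in> Q" if "vs \<in> ?S" for vs
    using that by (simp add: apartment_def presented_gen_class)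
  have S: "vs \<in> ?S" if "length vs = dim UNIV" "independent_tuple scale vs" for vs
    using that independent_tuple_nonzero by (simp add: nonzero_tuples_def)
  have "(\<lambda>vs. length vs = dim UNIV \<longrightarrow> independent_tuple scale vs \<longrightarrow> free_gen vs \<in> ?U) =
      (\<lambda>vs. length vs = dim UNIV \<longrightarrow> independent_tuple scale vs \<longrightarrow> apartment scale vs \<in> Q)"
    using mem S by blast
  then show "steinberg_closed UNIV (dim UNIV)
      (\<lambda>vs. length vs = dim UNIV \<longrightarrow> independent_tuple scale vs \<longrightarrow> apartment scale vs \<in> Q)"
    using steinberg_submodule_closed[OF U] by simp
  show "Q = carrier (steinberg scale)"
    if ind: "\<And>vs. \<lbrakk>length vs = dim UNIV; independent_tuple scale vs\<rbrakk> \<Longrightarrow> apartment scale vs \<in> Q"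
    unfolding steinberg_def
  proof (rule rat_presented_submodule_eq_carrier[OF Rel Q'])
    fix vs assume vs: "vs \<in> ?S"
    show "presented_gen ?S (steinberg_relations scale) vs \<in> Q"
    proof (cases "independent_tuple scale vs")
      case True
      then show ?thesis using ind[of vs] vs by (simp add: nonzero_tuples_def apartment_def)
    next
      case False
      then have "free_gen vs \<in> ?U" using U(2) steinberg_relation_dependent[OF vs] by blast
      then show ?thesis by (simp add: presented_gen_class)
    qed
  qed
qed

end

section \<open>Generation of the tensor square\<close>

theorem proposition37:
  fixes s :: "'f::field \<Rightarrow> 'v::ab_group_add \<Rightarrow> 'v"
    and Basis :: "'v set"
  assumes "finite_dimensional_vector_space s Basis"
  shows "submodule_generated rat_field (tensor_product (steinberg s) (steinberg s))
           (generic_coxeter_elements s)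
         = carrier (tensor_product (steinberg s) (steinberg s))"
proof -
  interpret finite_dimensional_vector_space s Basis by fact
  let ?St = "steinberg s" and ?d = "dim UNIV"
  let ?T = "tensor_product ?St ?St"
  note pre = pure_tensor_preimage[OF module_steinberg module_steinberg]
  interpret T: Module.module rat_field ?T
    by (rule module_tensor_product[OF module_steinberg module_steinberg])
  have nonzero: "vs \<in> nonzero_tuples ?d" if "length vs = ?d" "independent_tuple s vs" for vs
    using that independent_tuple_nonzero by (simp add: nonzero_tuples_def)
  \<comment> \<open>Treats every submodule containing the generic elements; the generated one is
    inserted at the end.\<close>
  have full: "carrier ?T \<subseteq> P"
    if P: "submodule P rat_field ?T" and gen: "generic_coxeter_elements s \<subseteq> P" for P
  proof -
    define t where "t p q = pure_tensor ?St ?St (apartment s p) (apartment s q)" for p q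
    let ?M = "\<lambda>p q. length p = ?d \<longrightarrow> independent_tuple s p \<longrightarrow>
      length q = ?d \<longrightarrow> independent_tuple s q \<longrightarrow> t p q \<in> P"
    have t: "t p q \<in> P"
      if pq: "length p = ?d" "independent_tuple s p" "length q = ?d" "independent_tuple s q" for p q
    proof -
      \<comment> \<open>If the fixed tuple is dependent or of the wrong length, the guarded
        predicate is constantly true.\<close>
      have trivial: "steinberg_closed UNIV ?d (\<lambda>_. True)" by (simp add: steinberg_closed_def)
      have "?M p q"
      proof (rule steinberg_closed_all)
        show "steinberg_closed UNIV ?d (\<lambda>p. ?M p q)" for q
        proof (cases "length q = ?d \<and> independent_tuple s q")
          case True
          then have q: "apartment s q \<in> carrier ?St" using apartment_carrier nonzero by blast
          have "(\<lambda>p. length p = ?d \<longrightarrow> independent_tuple s p \<longrightarrow>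
              apartment s p \<in> {x \<in> carrier ?St. pure_tensor ?St ?St x (apartment s q) \<in> P}) = (\<lambda>p. ?M p q)"
            using True apartment_carrier nonzero by (auto simp: t_def)
          then show ?thesis using steinberg_closed_apartment[OF pre(1)[OF P q]] by simp
        qed (use trivial in auto)
        show "steinberg_closed UNIV ?d (?M p)" for p
        proof (cases "length p = ?d \<and> independent_tuple s p")
          case True
          then have p: "apartment s p \<in> carrier ?St" using apartment_carrier nonzero by blast
          have "(\<lambda>q. length q = ?d \<longrightarrow> independent_tuple s q \<longrightarrow>
              apartment s q \<in> {y \<in> carrier ?St. pure_tensor ?St ?St (apartment s p) y \<in> P}) = ?M p"
            using True apartment_carrier nonzero by (auto simp: t_def)
          then show ?thesis using steinberg_closed_apartment[OF pre(2)[OF P p]] by simp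
        qed (use trivial in auto)
        fix p :: "'v list" assume p: "length p = ?d" "independent_tuple s p"
        \<comment> \<open>The lines of a single path form a generic Coxeter pair, and
          \<open>simplex_class\<close> of these lines gives back the two apartments.\<close>
        show "?M p (differences 0 p)"
        proof (intro impI)
          let ?l = "\<lambda>v. span {v}"
          assume "length (differences 0 p) = ?d" "independent_tuple s (differences 0 p)"
          then have "t p (differences 0 p) = pure_tensor ?St ?St
              (simplex_class s (map ?l p)) (simplex_class s (map ?l (differences 0 p)))"
            using p nonzero simplex_class_lines by (simp add: t_def)
          then show "t p (differences 0 p) \<in> P"
            using gen generic_coxeter_pair_differences[OF p] unfolding generic_coxeter_elements_def by blast
        qed
      qed (use pq in auto)
      then show ?thesis using pq by blast
    qed
    \<comment> \<open>Linearity extends membership from apartments to all elements, first in the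
      left factor and then in the right.\<close>
    have left: "pure_tensor ?St ?St x (apartment s q) \<in> P"
      if x: "x \<in> carrier ?St" and q: "length q = ?d" "independent_tuple s q" for x q
    proof -
      have "{x \<in> carrier ?St. pure_tensor ?St ?St x (apartment s q) \<in> P} = carrier ?St"
        using q t apartment_carrier nonzero
        by (intro steinberg_submodule_eq_carrier[OF pre(1)[OF P]]) (auto simp: t_def)
      then show ?thesis using x by blast
    qed
    have pure: "pure_tensor ?St ?St x y \<in> P" if x: "x \<in> carrier ?St" and y: "y \<in> carrier ?St" for x y
    proof -
      have "{y \<in> carrier ?St. pure_tensor ?St ?St x y \<in> P} = carrier ?St"
        using x left apartment_carrier nonzero
        by (intro steinberg_submodule_eq_carrier[OF pre(2)[OF P]]) auto
      then show ?thesis using y by blast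
    qed
    have "P = carrier ?T"
      unfolding tensor_product_def
    proof (rule rat_presented_submodule_eq_carrier)
      show "tensor_relations ?St ?St \<subseteq> carrier (free_rat_module (carrier ?St \<times> carrier ?St))"
        by (rule tensor_relations_carrier[OF module_steinberg module_steinberg])
      show "submodule P rat_field (rat_presented (carrier ?St \<times> carrier ?St) (tensor_relations ?St ?St))"
        using P unfolding tensor_product_def .
      show "presented_gen (carrier ?St \<times> carrier ?St) (tensor_relations ?St ?St) z \<in> P"
        if "z \<in> carrier ?St \<times> carrier ?St" for z
        using that pure by (auto simp: pure_tensor_def)
    qed
    then show ?thesis by simp
  qed
  \<comment> \<open>The generated set is a submodule once its generators lie in the carrier; for
    this the chosen generators of lines must be nonzero.\<close>
  have "simplex_class s R \<in> carrier ?St" if R: "projective_simplex s R" for R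
  proof -
    have "line_generator s L \<noteq> 0" if L: "L \<in> set R" for L
    proof -
      obtain v where "v \<noteq> 0" "L = span {v}"
        using R L unfolding projective_simplex_def is_line_def by blast
      then show ?thesis using line_generator_span[of v] by auto
    qed
    then have "0 \<notin> set (map (line_generator s) R)" by (metis imageE set_map)
    then have "map (line_generator s) R \<in> nonzero_tuples ?d"
      using R by (simp add: nonzero_tuples_def projective_simplex_def)
    then show ?thesis unfolding simplex_class_def by (rule apartment_carrier)
  qed
  then have gens: "generic_coxeter_elements s \<subseteq> carrier ?T"
    using pure_tensor_carrier[OF module_steinberg module_steinberg]
    by (auto simp: generic_coxeter_elements_def generic_coxeter_pair_def coxeter_pair_def)
  show ?thesis
  proof
    show "submodule_generated rat_field ?T (generic_coxeter_elements s) \<subseteq> carrier ?T"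
      by (rule submodule_generated_least[OF T.carrier_is_submodule gens])
    show "carrier ?T \<subseteq> submodule_generated rat_field ?T (generic_coxeter_elements s)"
      by (rule full[OF T.submodule_generated_submodule[OF gens] submodule_generated_superset])
  qed
qed

end
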